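(* For every graph $G$, $$\mathrm{mfi}(G)\le \mathrm{mci}(G)\le 4\,\mathrm{mfi}(G)+3,$$ $$\mathrm{mfi}(G)\le \mathrm{pl}(G)\le 16\,\mathrm{mfi}(G)+10,$$ $$\frac{\mathrm{mfi}(G)}{2}\le\mathrm{pat}(G)\le 8\,\mathrm{mfi}(G)+5,$$ $$\frac{\mathrm{mfi}(G)-1}{2}\le\mathrm{adc}(G)\le 16\,\mathrm{mfi}(G)+10,$$ $$\mathrm{mfi}(G)\le\Delta(G)\le 16\,\mathrm{mfi}(G)+12,$$ $$\frac{\mathrm{mfi}(G)}{4}\le\mathrm{dsp}(G)\le \mathrm{dpr}(G)\le 8\,\mathrm{mfi}(G)+5,$$ $$\frac{\mathrm{mfi}(G)}{2}\le\mathrm{pcc}(G)\le 16\,\mathrm{mfi}(G)+10.$$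
   Context: All graphs are nonempty, connected, finite, unweighted, undirected, loopless, without multiple edges. $d_G(u,v)$ is the number of edges of a shortest path of $G$ between $u$ and $v$; $d_G(S_1,S_2)=\min\{d_G(x,y):x\in S_1,y\in S_2\}$; $D_G(v,r)=\{u: d_G(u,v)\le r\}$. For an integer $k\ge1$, the power $G^k$ has the same vertex set as $G$, two distinct vertices being adjacent iff their distance in $G$ is at most $k$. Fat minors ($K\ge1$ an integer). $G$ has a $K$-fat $K_3$-minor if there are three connected subgraphs $H_1,H_2,H_3$ and three simple paths $P_{1,2},P_{2,3},P_{1,3}$ in $G$ such that for each $i\ne j$, $P_{i,j}$ has one end in $H_i$ and the other in $H_j$, $|P_{i,j}\cap V(H_i)|=|P_{i,j}\cap V(H_j)|=1$, $d_G(V(H_i),V(H_j))\ge K$, $d_G(P_{i,j},V(H_k))\ge K$ for $k\in\{1,2,3\}\setminus\{i,j\}$, and the distance between any two of the three paths is at least $K$. $G$ has a $K$-fat $K_{1,3}$-minor if there are four connected subgraphs $H_0,H_1,H_2,H_3$ and three simple paths $P_{1,0},P_{2,0},P_{3,0}$ in $G$ such that for each $i\in\{1,2,3\}$, $P_{i,0}$ has one end in $H_i$ and the other in $H_0$, $|P_{i,0}\cap V(H_i)|=|P_{i,0}\cap V(H_0)|=1$, $d_G(V(H_i),V(H_j))\ge K$ for all distinct $i,j\in\{0,1,2,3\}$, $d_G(P_{i,0},V(H_k))\ge K$ for $k\in\{1,2,3\}$, $k\ne i$, and the distance between any two of the three paths is at least $K$. $\mathrm{mfi}(G)$ is the largest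 $K>0$ such that $G$ has a $K$-fat $K_3$-minor or a $K$-fat $K_{1,3}$-minor ($\mathrm{mfi}(G)=0$ if there is none). McCarty index: $\mathrm{mci}(G)$ is the minimum integer $r\ge 0$ such that for every triple of distinct vertices $u,v,w$, the disk of radius $r$ centered at one of them contains a vertex of every path of $G$ connecting the two others. A path-decomposition of $G=(V,E)$ is a sequence $X_1,\dots,X_q$ of subsets of $V$ (bags) such that $\bigcup_i X_i=V$; every edge has both ends in some bag; and $X_i\cap X_k\subseteq X_j$ whenever $i\le j\le k$. Its length is $\max_i\max_{u,v\in X_i} d_G(u,v)$. $\mathrm{pl}(G)$ is the minimum length over all path-decompositions of $G$. For $s\in V$ let $L_i=\{u\in V: d_G(s,u)=i\}$, $i=0,\dots,q$, $q=\max_u d_G(s,u)$. For $i\ge 1$ let $L_i^+$ be $L_i$ together with all vertices of $L_{i-1}$ that have a neighbor in $L_i$. The sequence $(L_1^+,\dots,L_q^+)$ is a path-decomposition of $G$ (if $q=0$, it is taken to be the single bag $\{s\}$); $\Delta_s(G)$ denotes its length and $\Delta(G)=\min_{s\in V}\Delta_s(G)$. A caterpillar tree is an (unweighted) tree in which all vertices are within distance 1 of some path of the tree. $\mathrm{adc}(G)$ is the minimum integer $k\ge 0$ such that there is a caterpillar tree $T$ on the vertex set $V$ with $|d_G(u,v)-d_T(u,v)|\le k$ for all $u,v\in V$. A path $P$ of $G$ is $k$-dominating if every vertex of $G$ is at distance at most $k$ from some vertex of $P$. A pair of vertices $x,y$ (not necessarily distinct) is a $k$-dominating pair if every path of $G$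 between $x$ and $y$ is $k$-dominating. $\mathrm{dsp}(G)$ is the minimum $k\ge0$ such that $G$ has a $k$-dominating shortest path (a $k$-dominating path that is a shortest path of $G$ between its ends); $\mathrm{dpr}(G)$ is the minimum $k\ge0$ such that $G$ has a $k$-dominating pair. An asteroidal triple is an independent set of three vertices such that each two are joined by a path avoiding the closed neighborhood of the third. A graph is AT-free if it has no asteroidal triple. A graph is a cocomparability graph if its vertices admit a linear ordering with no triple $x<y<z$ such that $xy\notin E$, $yz\notin E$, $xz\in E$. $\mathrm{pat}(G)$ (resp. $\mathrm{pcc}(G)$) is the minimum integer $k\ge 1$ such that $G^k$ is AT-free (resp. a cocomparability graph). *)

theory Defs
  imports Complex_Main
begin

section \<open>Graphs, paths and distances\<close>

record 'a ugraph =
  verts :: "'a set"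
  edges :: "'a set set"

definition simple_graph :: "'a ugraph \<Rightarrow> bool" where
  "simple_graph G \<longleftrightarrow>
     finite (verts G) \<and> verts G \<noteq> {} \<and> (\<forall>e\<in>edges G. e \<subseteq> verts G \<and> card e = 2)"

definition adj :: "'a ugraph \<Rightarrow> 'a \<Rightarrow> 'a \<Rightarrow> bool" where
  "adj G u v \<longleftrightarrow> {u, v} \<in> edges G"

text \<open>A path is the nonempty list of its vertices, all distinct (a single vertex is a path).\<close>

definition gpath :: "'a ugraph \<Rightarrow> 'a list \<Rightarrow> bool" where
  "gpath G p \<longleftrightarrow> p \<noteq> [] \<and> set p \<subseteq> verts G \<and> distinct p \<and> successively (adj G) p"

definition path_between :: "'a ugraph \<Rightarrow> 'a \<Rightarrow> 'a \<Rightarrow> 'a list \<Rightarrow> bool" where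
  "path_between G u v p \<longleftrightarrow> gpath G p \<and> hd p = u \<and> last p = v"

definition path_length :: "'a list \<Rightarrow> nat" where
  "path_length p = length p - 1"

definition connected_graph :: "'a ugraph \<Rightarrow> bool" where
  "connected_graph G \<longleftrightarrow>
     simple_graph G \<and> (\<forall>u\<in>verts G. \<forall>v\<in>verts G. \<exists>p. path_between G u v p)"

text \<open>Meaningful only for vertices joined by a path; below it is used only in connected graphs.\<close>

definition gdist :: "'a ugraph \<Rightarrow> 'a \<Rightarrow> 'a \<Rightarrow> nat" where
  "gdist G u v = (LEAST n. \<exists>p. path_between G u v p \<and> path_length p = n)"

text \<open>Meaningful only for finite nonempty sets.\<close>

definition set_gdist :: "'a ugraph \<Rightarrow> 'a set \<Rightarrow> 'a set \<Rightarrow> nat" where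
  "set_gdist G A B = Min {gdist G x y | x y. x \<in> A \<and> y \<in> B}"

definition disk :: "'a ugraph \<Rightarrow> 'a \<Rightarrow> nat \<Rightarrow> 'a set" where
  "disk G v r = {u \<in> verts G. gdist G u v \<le> r}"

definition closed_nbhd :: "'a ugraph \<Rightarrow> 'a \<Rightarrow> 'a set" where
  "closed_nbhd G v = insert v {u \<in> verts G. adj G u v}"

definition graph_power :: "'a ugraph \<Rightarrow> nat \<Rightarrow> 'a ugraph" where
  "graph_power G k =
     \<lparr>verts = verts G,
      edges = {{u, v} | u v. u \<in> verts G \<and> v \<in> verts G \<and> u \<noteq> v \<and> gdist G u v \<le> k}\<rparr>"

definition connected_subgraph :: "'a ugraph \<Rightarrow> 'a ugraph \<Rightarrow> bool" where
  "connected_subgraph H G \<longleftrightarrow>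
     connected_graph H \<and> verts H \<subseteq> verts G \<and> edges H \<subseteq> edges G"

section \<open>Fat minors\<close>

definition links :: "'a ugraph \<Rightarrow> 'a list \<Rightarrow> 'a ugraph \<Rightarrow> 'a ugraph \<Rightarrow> bool" where
  "links G p H H' \<longleftrightarrow>
     gpath G p \<and> hd p \<in> verts H \<and> last p \<in> verts H' \<and>
     card (set p \<inter> verts H) = 1 \<and> card (set p \<inter> verts H') = 1"

text \<open>The paths joining branch sets \<open>i\<close> and \<open>j\<close> are recorded for \<open>i < j\<close> only.\<close>

definition fat_K3_minor :: "'a ugraph \<Rightarrow> nat \<Rightarrow> bool" where
  "fat_K3_minor G K \<longleftrightarrow>
     (\<exists>(H :: nat \<Rightarrow> 'a ugraph) (P :: nat \<Rightarrow> nat \<Rightarrow> 'a list).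
        (\<forall>i\<in>{1,2,3}. connected_subgraph (H i) G) \<and>
        (\<forall>i\<in>{1,2,3}. \<forall>j\<in>{1,2,3}. i < j \<longrightarrow> links G (P i j) (H i) (H j)) \<and>
        (\<forall>i\<in>{1,2,3}. \<forall>j\<in>{1,2,3}. i \<noteq> j \<longrightarrow>
           K \<le> set_gdist G (verts (H i)) (verts (H j))) \<and>
        (\<forall>i\<in>{1,2,3}. \<forall>j\<in>{1,2,3}. \<forall>k\<in>{1,2,3}. i < j \<longrightarrow> k \<noteq> i \<longrightarrow> k \<noteq> j \<longrightarrow>
           K \<le> set_gdist G (set (P i j)) (verts (H k))) \<and>
        (\<forall>i\<in>{1,2,3}. \<forall>j\<in>{1,2,3}. \<forall>i'\<in>{1,2,3}. \<forall>j'\<in>{1,2,3}.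
           i < j \<longrightarrow> i' < j' \<longrightarrow> (i, j) \<noteq> (i', j') \<longrightarrow>
           K \<le> set_gdist G (set (P i j)) (set (P i' j'))))"

text \<open>Branch set \<open>0\<close> is the centre of the claw, and \<open>P i\<close> joins branch set \<open>i\<close> to it.\<close>

definition fat_K13_minor :: "'a ugraph \<Rightarrow> nat \<Rightarrow> bool" where
  "fat_K13_minor G K \<longleftrightarrow>
     (\<exists>(H :: nat \<Rightarrow> 'a ugraph) (P :: nat \<Rightarrow> 'a list).
        (\<forall>i\<in>{0,1,2,3}. connected_subgraph (H i) G) \<and>
        (\<forall>i\<in>{1,2,3}. links G (P i) (H i) (H 0)) \<and>
        (\<forall>i\<in>{0,1,2,3}. \<forall>j\<in>{0,1,2,3}. i \<noteq> j \<longrightarrow>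
           K \<le> set_gdist G (verts (H i)) (verts (H j))) \<and>
        (\<forall>i\<in>{1,2,3}. \<forall>k\<in>{1,2,3}. k \<noteq> i \<longrightarrow>
           K \<le> set_gdist G (set (P i)) (verts (H k))) \<and>
        (\<forall>i\<in>{1,2,3}. \<forall>j\<in>{1,2,3}. i \<noteq> j \<longrightarrow>
           K \<le> set_gdist G (set (P i)) (set (P j))))"

text \<open>For a connected graph the set below is finite, as \<open>K\<close> is bounded by the diameter.\<close>

definition mfi :: "'a ugraph \<Rightarrow> nat" where
  "mfi G = Max (insert 0 {K. 0 < K \<and> (fat_K3_minor G K \<or> fat_K13_minor G K)})"

section \<open>McCarty index\<close>

definition disk_hits_paths :: "'a ugraph \<Rightarrow> nat \<Rightarrow> 'a \<Rightarrow> 'a \<Rightarrow> 'a \<Rightarrow> bool" where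
  "disk_hits_paths G r u v w \<longleftrightarrow> (\<forall>p. path_between G v w p \<longrightarrow> disk G u r \<inter> set p \<noteq> {})"

definition mci :: "'a ugraph \<Rightarrow> nat" where
  "mci G = (LEAST r. \<forall>u\<in>verts G. \<forall>v\<in>verts G. \<forall>w\<in>verts G.
     u \<noteq> v \<longrightarrow> u \<noteq> w \<longrightarrow> v \<noteq> w \<longrightarrow>
     disk_hits_paths G r u v w \<or> disk_hits_paths G r v u w \<or> disk_hits_paths G r w u v)"

section \<open>Path-length and layerings\<close>

definition path_decomposition :: "'a ugraph \<Rightarrow> 'a set list \<Rightarrow> bool" where
  "path_decomposition G Xs \<longleftrightarrow>
     \<Union> (set Xs) = verts G \<and>
     (\<forall>e\<in>edges G. \<exists>X\<in>set Xs. e \<subseteq> X) \<and>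
     (\<forall>i j k. i \<le> j \<and> j \<le> k \<and> k < length Xs \<longrightarrow> Xs ! i \<inter> Xs ! k \<subseteq> Xs ! j)"

definition decomposition_length :: "'a ugraph \<Rightarrow> 'a set list \<Rightarrow> nat" where
  "decomposition_length G Xs = Max {gdist G u v | u v. \<exists>X\<in>set Xs. u \<in> X \<and> v \<in> X}"

definition pl :: "'a ugraph \<Rightarrow> nat" where
  "pl G = (LEAST l. \<exists>Xs. path_decomposition G Xs \<and> decomposition_length G Xs = l)"

definition layer :: "'a ugraph \<Rightarrow> 'a \<Rightarrow> nat \<Rightarrow> 'a set" where
  "layer G s i = {u \<in> verts G. gdist G s u = i}"

definition ext_layer :: "'a ugraph \<Rightarrow> 'a \<Rightarrow> nat \<Rightarrow> 'a set" where
  "ext_layer G s i = layer G s i \<union> {u \<in> layer G s (i - 1). \<exists>w\<in>layer G s i. adj G u w}"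

definition eccentricity :: "'a ugraph \<Rightarrow> 'a \<Rightarrow> nat" where
  "eccentricity G s = Max (gdist G s ` verts G)"

definition layer_decomposition :: "'a ugraph \<Rightarrow> 'a \<Rightarrow> 'a set list" where
  "layer_decomposition G s =
     (if eccentricity G s = 0 then [{s}]
      else map (ext_layer G s) [1..<Suc (eccentricity G s)])"

definition layering_length :: "'a ugraph \<Rightarrow> 'a \<Rightarrow> nat" where
  "layering_length G s = decomposition_length G (layer_decomposition G s)"

definition min_layering_length :: "'a ugraph \<Rightarrow> nat" where
  "min_layering_length G = Min (layering_length G ` verts G)"

section \<open>Additive distortion to caterpillar trees\<close>

definition is_cycle :: "'a ugraph \<Rightarrow> 'a list \<Rightarrow> bool" where
  "is_cycle G c \<longleftrightarrow> gpath G c \<and> 3 \<le> length c \<and> adj G (last c) (hd c)"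

definition is_tree :: "'a ugraph \<Rightarrow> bool" where
  "is_tree T \<longleftrightarrow> connected_graph T \<and> (\<nexists>c. is_cycle T c)"

definition dominating_path :: "'a ugraph \<Rightarrow> nat \<Rightarrow> 'a list \<Rightarrow> bool" where
  "dominating_path G k p \<longleftrightarrow> gpath G p \<and> (\<forall>v\<in>verts G. \<exists>x\<in>set p. gdist G v x \<le> k)"

definition caterpillar :: "'a ugraph \<Rightarrow> bool" where
  "caterpillar T \<longleftrightarrow> is_tree T \<and> (\<exists>p. dominating_path T 1 p)"

definition adc :: "'a ugraph \<Rightarrow> nat" where
  "adc G = (LEAST k. \<exists>T. caterpillar T \<and> verts T = verts G \<and>
     (\<forall>u\<in>verts G. \<forall>v\<in>verts G. \<bar>int (gdist G u v) - int (gdist T u v)\<bar> \<le> int k))"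

section \<open>Dominating shortest paths and dominating pairs\<close>

definition shortest_path :: "'a ugraph \<Rightarrow> 'a list \<Rightarrow> bool" where
  "shortest_path G p \<longleftrightarrow> gpath G p \<and> path_length p = gdist G (hd p) (last p)"

definition dsp :: "'a ugraph \<Rightarrow> nat" where
  "dsp G = (LEAST k. \<exists>p. shortest_path G p \<and> dominating_path G k p)"

definition dominating_pair :: "'a ugraph \<Rightarrow> nat \<Rightarrow> 'a \<Rightarrow> 'a \<Rightarrow> bool" where
  "dominating_pair G k x y \<longleftrightarrow>
     x \<in> verts G \<and> y \<in> verts G \<and> (\<forall>p. path_between G x y p \<longrightarrow> dominating_path G k p)"

definition dpr :: "'a ugraph \<Rightarrow> nat" where
  "dpr G = (LEAST k. \<exists>x y. dominating_pair G k x y)"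

section \<open>Powers that are AT-free or cocomparability graphs\<close>

definition joined_avoiding :: "'a ugraph \<Rightarrow> 'a \<Rightarrow> 'a \<Rightarrow> 'a \<Rightarrow> bool" where
  "joined_avoiding G u v w \<longleftrightarrow> (\<exists>p. path_between G u v p \<and> set p \<inter> closed_nbhd G w = {})"

definition asteroidal_triple :: "'a ugraph \<Rightarrow> 'a \<Rightarrow> 'a \<Rightarrow> 'a \<Rightarrow> bool" where
  "asteroidal_triple G u v w \<longleftrightarrow>
     u \<in> verts G \<and> v \<in> verts G \<and> w \<in> verts G \<and> u \<noteq> v \<and> u \<noteq> w \<and> v \<noteq> w \<and>
     \<not> adj G u v \<and> \<not> adj G u w \<and> \<not> adj G v w \<and>
     joined_avoiding G u v w \<and> joined_avoiding G u w v \<and> joined_avoiding G v w u"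

definition AT_free :: "'a ugraph \<Rightarrow> bool" where
  "AT_free G \<longleftrightarrow> (\<nexists>u v w. asteroidal_triple G u v w)"

definition cocomparability :: "'a ugraph \<Rightarrow> bool" where
  "cocomparability G \<longleftrightarrow>
     (\<exists>r. linear_order_on (verts G) r \<and>
        \<not> (\<exists>x\<in>verts G. \<exists>y\<in>verts G. \<exists>z\<in>verts G.
             (x, y) \<in> r \<and> x \<noteq> y \<and> (y, z) \<in> r \<and> y \<noteq> z \<and>
             \<not> adj G x y \<and> \<not> adj G y z \<and> adj G x z))"

definition pat :: "'a ugraph \<Rightarrow> nat" where
  "pat G = (LEAST k. 1 \<le> k \<and> AT_free (graph_power G k))"

definition pcc :: "'a ugraph \<Rightarrow> nat" where
  "pcc G = (LEAST k. 1 \<le> k \<and> cocomparability (graph_power G k))"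

end

theory Submission
  imports Defs
begin

text \<open>Call a triple of vertices \<open>K\<close>-wide if any two of them are joined by a path that stays at distance
  at least \<open>K\<close> from the third. A \<open>K\<close>-fat \<open>K\<^sub>3\<close>- or \<open>K\<^sub>1\<^sub>,\<^sub>3\<close>-minor yields a \<open>K\<close>-wide triple, and each of
  the parameters bounds the width of triples: \<open>mci\<close> and \<open>pat\<close> almost by definition, \<open>pl\<close>, \<open>dsp\<close>,
  \<open>pcc\<close> and \<open>adc\<close> because one of any three vertices lies between the other two along the linear
  structure.

  Conversely, a \<open>(4 * K - 1)\<close>-wide triple yields a \<open>K\<close>-fat minor, so with \<open>r = 4 * mfi G + 2\<close> no triple is
  \<open>(r + 1)\<close>-wide. Let \<open>s\<close>, \<open>t\<close> be a diametral pair. Two vertices in the same layer of \<open>s\<close> are then within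
  \<open>2 * r\<close> of each other, or both are within \<open>2 * r\<close> of \<open>s\<close>. Hence the layers have diameter at most \<open>4 * r\<close>,
  which bounds \<open>\<Delta>\<close>, \<open>pl\<close> and \<open>adc\<close>; ordering the vertices by layer shows that \<open>G\<close> to the power \<open>4 * r\<close>
  is a cocomparability graph, and \<open>s\<close>, \<open>t\<close> is a \<open>2 * r\<close>-dominating pair.\<close>

section \<open>Paths and distances\<close>

text \<open>The width \<open>4 * K - 1\<close> is the price of two opposing demands on a radius
  \<open>R\<close>. The branch sets of the \<open>K\<^sub>3\<close>-minor are the disks of radius
  \<open>R\<close> about the triple, and keeping them \<open>K\<close> apart requires the width to
  be at least \<open>2 * R + K\<close>. On the other hand, two linking paths outside these disks
  that come closer than \<open>K\<close> to each other must be joinable outside the disks of radius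
  \<open>K - 1\<close>, so that a claw results; as each vertex of a geodesic is close to one of its
  ends, this requires \<open>2 * R\<close> to be at least \<open>3 * K - 2\<close>. Rounding
  \<open>R\<close> to an integer leads to \<open>4 * K - 1\<close>.

  For the upper bounds, a disk of radius \<open>r\<close> about \<open>c\<close> that meets all
  paths from \<open>u\<close> to \<open>v\<close> also meets a geodesic, so the detour from
  \<open>u\<close> to \<open>v\<close> through \<open>c\<close> is longer by at most
  \<open>2 * r\<close>. The layering cannot start anywhere: seen from the middle of a long path, a
  layer consists of two vertices far apart. An end \<open>s\<close> of a diametral pair excludes
  this, because whatever the disk about \<open>s\<close> cuts off from \<open>t\<close> has to be
  near \<open>s\<close>.\<close>

lemma adj_commute: "adj G u v \<longleftrightarrow> adj G v u"
  by (simp add: adj_def insert_commute)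

lemma gpath_rev: "gpath G (rev p) \<longleftrightarrow> gpath G p"
proof -
  have "successively (\<lambda>x y. adj G y x) p = successively (adj G) p"
    by (intro arg_cong[where f = "\<lambda>R. successively R p"] ext) (rule adj_commute)
  then show ?thesis
    by (simp only: gpath_def successively_rev rev_is_Nil_conv set_rev distinct_rev)
qed

lemma path_between_rev: "path_between G u v p \<Longrightarrow> path_between G v u (rev p)"
  unfolding path_between_def gpath_rev by (auto simp: hd_rev last_rev gpath_def)

lemma gpath_appendD1: "gpath G (p @ q) \<Longrightarrow> p \<noteq> [] \<Longrightarrow> gpath G p"
  by (auto simp: gpath_def successively_append_iff)

lemma gpath_appendD2: "gpath G (p @ q) \<Longrightarrow> q \<noteq> [] \<Longrightarrow> gpath G q"
  by (auto simp: gpath_def successively_append_iff)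

text \<open>Induction on the walk: if the new head already lies on the path found for the rest, the
  loop back to it is cut off.\<close>

lemma path_of_walk:
  assumes "p \<noteq> []" "set p \<subseteq> verts G" "successively (adj G) p"
  shows "\<exists>q. path_between G (hd p) (last p) q \<and> set q \<subseteq> set p \<and> length q \<le> length p"
  using assms
proof (induction p rule: induct_list012)
  case 1
  then show ?case by simp
next
  case (2 x)
  then show ?case
    by (intro exI[of _ "[x]"]) (auto simp: path_between_def gpath_def)
next
  case (3 x y zs)
  then obtain q where q: "path_between G y (last (y # zs)) q" "set q \<subseteq> set (y # zs)"
      "length q \<le> length (y # zs)"
    by auto
  show ?case
  proof (cases "x \<in> set q")
    case True
    then obtain a b where ab: "q = a @ x # b"
      by (meson split_list)
    have "path_between G x (last (y # zs)) (x # b)"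
      using q ab gpath_appendD2[of G a "x # b"] by (auto simp: path_between_def)
    then show ?thesis
      using q ab by (intro exI[of _ "x # b"]) auto
  next
    case False
    have "path_between G x (last (y # zs)) (x # q)"
      using q False 3 by (cases q) (auto simp: path_between_def gpath_def)
    then show ?thesis
      using q by (intro exI[of _ "x # q"]) auto
  qed
qed

lemma path_between_trans:
  assumes "path_between G u v p" "path_between G v w q"
  obtains r where "path_between G u w r" "set r \<subseteq> set p \<union> set q" "length r < length p + length q"
proof -
  obtain q' where q': "q = v # q'"
    using assms by (cases q) (auto simp: path_between_def gpath_def)
  have "successively (adj G) (p @ q')" "set (p @ q') \<subseteq> verts G" "p @ q' \<noteq> []"
    and hl: "hd (p @ q') = u" "last (p @ q') = w"
    using assms unfolding q'
    by (auto simp: path_between_def gpath_def successively_append_iff successively_Cons last_append)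
  then obtain r where "path_between G u w r" "set r \<subseteq> set (p @ q')" "length r \<le> length (p @ q')"
    using path_of_walk[of "p @ q'" G] unfolding hl by blast
  then show thesis
    using that[of r] q' by auto
qed

section \<open>Connections inside a set of vertices\<close>

definition joined_in :: "'a ugraph \<Rightarrow> 'a set \<Rightarrow> 'a \<Rightarrow> 'a \<Rightarrow> bool" where
  "joined_in G S u v \<longleftrightarrow> (\<exists>p. path_between G u v p \<and> set p \<subseteq> S)"

lemma joined_in_refl: "u \<in> verts G \<Longrightarrow> u \<in> S \<Longrightarrow> joined_in G S u u"
  unfolding joined_in_def by (intro exI[of _ "[u]"]) (auto simp: path_between_def gpath_def)

lemma joined_in_sym: "joined_in G S u v \<Longrightarrow> joined_in G S v u"
  unfolding joined_in_def by (metis path_between_rev set_rev)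

lemma joined_in_mono: "joined_in G S u v \<Longrightarrow> S \<subseteq> S' \<Longrightarrow> joined_in G S' u v"
  unfolding joined_in_def by blast

lemma joined_inD:
  assumes "joined_in G S u v"
  shows "u \<in> verts G" "v \<in> verts G" "u \<in> S" "v \<in> S"
  using assms by (auto simp: joined_in_def path_between_def gpath_def)

lemma joined_in_path:
  assumes "path_between G u v p" "set p \<subseteq> S" "x \<in> set p"
  shows "joined_in G S u x" "joined_in G S x v"
proof -
  obtain a b where ab: "p = a @ x # b"
    using assms(3) by (meson split_list)
  have "path_between G u x (a @ [x])" "path_between G x v (x # b)"
    using assms(1) gpath_appendD1[of G "a @ [x]" b] gpath_appendD2[of G a "x # b"]
    unfolding ab path_between_def by (auto simp: hd_append)
  then show "joined_in G S u x" "joined_in G S x v"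
    using assms(2) ab unfolding joined_in_def by (force, force)
qed

lemma joined_in_adj:
  assumes "adj G u v" "u \<in> verts G" "v \<in> verts G" "u \<noteq> v" "u \<in> S" "v \<in> S"
  shows "joined_in G S u v"
  unfolding joined_in_def using assms
  by (intro exI[of _ "[u, v]"]) (auto simp: path_between_def gpath_def)

lemma joined_in_trans:
  assumes "joined_in G S u v" "joined_in G S v w"
  shows "joined_in G S u w"
proof -
  obtain p q where p: "path_between G u v p" "set p \<subseteq> S" and q: "path_between G v w q" "set q \<subseteq> S"
    using assms by (auto simp: joined_in_def)
  obtain r where "path_between G u w r" "set r \<subseteq> set p \<union> set q"
    using path_between_trans[OF p(1) q(1)] .
  then show ?thesis
    using p(2) q(2) unfolding joined_in_def by blast
qed

text \<open>The common form of the separation arguments below: \<open>Q\<close> says that a vertex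
  is still on the near side of a separator, and no edge inside \<open>S\<close> leads
  across.\<close>

lemma joined_in_invariant:
  assumes "joined_in G S u v" "Q u"
    and step: "\<And>x y. x \<in> S \<Longrightarrow> y \<in> S \<Longrightarrow> x \<in> verts G \<Longrightarrow> y \<in> verts G \<Longrightarrow> x \<noteq> y \<Longrightarrow>
      adj G x y \<Longrightarrow> Q x \<Longrightarrow> Q y"
  shows "Q v"
proof -
  obtain p where p: "path_between G u v p" "set p \<subseteq> S"
    using assms by (auto simp: joined_in_def)
  have "Q (last p)" if "gpath G p" "set p \<subseteq> S" "Q (hd p)" for p
    using that
  proof (induction p rule: induct_list012)
    case (3 x y zs)
    have "Q y"
      using 3(3-) by (intro step[of x y]) (auto simp: gpath_def)
    then show ?case
      using 3 by (auto simp: gpath_def)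
  qed (auto simp: gpath_def)
  then show ?thesis
    using p \<open>Q u\<close> by (auto simp: path_between_def)
qed

section \<open>The metric of a connected graph\<close>

locale conn_graph =
  fixes G :: "'a ugraph"
  assumes connected: "connected_graph G"
begin

lemma finite_verts: "finite (verts G)"
  and verts_nonempty: "verts G \<noteq> {}"
  using connected by (auto simp: connected_graph_def simple_graph_def)

lemma adjD:
  assumes "adj G u v"
  shows "u \<in> verts G" "v \<in> verts G" "u \<noteq> v"
proof -
  have "{u, v} \<subseteq> verts G" "card {u, v} = 2"
    using assms connected by (auto simp: connected_graph_def simple_graph_def adj_def)
  then show "u \<in> verts G" "v \<in> verts G" "u \<noteq> v"
    by auto
qed

lemma gdist_le: "path_between G u v p \<Longrightarrow> gdist G u v \<le> length p - 1"
  unfolding gdist_def by (rule Least_le) (auto simp: path_length_def)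

lemma geodesic_exists:
  assumes "u \<in> verts G" "v \<in> verts G"
  obtains p where "path_between G u v p" "length p = Suc (gdist G u v)"
proof -
  obtain q where "path_between G u v q"
    using assms connected by (auto simp: connected_graph_def)
  then have "\<exists>p. path_between G u v p \<and> path_length p = gdist G u v"
    unfolding gdist_def by (intro LeastI_ex[where P = "\<lambda>n. \<exists>p. path_between G u v p \<and> path_length p = n"]) blast
  then obtain p where "path_between G u v p" "path_length p = gdist G u v"
    by blast
  moreover from this have "p \<noteq> []"
    by (auto simp: path_between_def gpath_def)
  ultimately show thesis
    using that by (cases p) (auto simp: path_length_def)
qed

lemma gdist_commute:
  assumes "u \<in> verts G" "v \<in> verts G"
  shows "gdist G u v = gdist G v u"
proof -
  have "gdist G v u \<le> gdist G u v" if uv: "u \<in> verts G" "v \<in> verts G" for u v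
  proof -
    obtain p where "path_between G u v p" "length p = Suc (gdist G u v)"
      using geodesic_exists[OF uv] .
    then show ?thesis
      using gdist_le[OF path_between_rev] by fastforce
  qed
  then show ?thesis
    using assms by (simp add: antisym)
qed

lemma gdist_triangle:
  assumes "u \<in> verts G" "v \<in> verts G" "w \<in> verts G"
  shows "gdist G u w \<le> gdist G u v + gdist G v w"
proof -
  obtain p where p: "path_between G u v p" "length p = Suc (gdist G u v)"
    using geodesic_exists[OF assms(1,2)] .
  obtain q where q: "path_between G v w q" "length q = Suc (gdist G v w)"
    using geodesic_exists[OF assms(2,3)] .
  obtain r where r: "path_between G u w r" "length r < length p + length q"
    using path_between_trans[OF p(1) q(1)] .
  then show ?thesis
    using gdist_le[OF r(1)] p(2) q(2) by linarith
qed

lemma gdist_self [simp]: "u \<in> verts G \<Longrightarrow> gdist G u u = 0"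
  using gdist_le[of u u "[u]"] by (simp add: path_between_def gpath_def)

lemma gdist_eq_0:
  assumes "u \<in> verts G" "v \<in> verts G"
  shows "gdist G u v = 0 \<longleftrightarrow> u = v"
proof
  assume "gdist G u v = 0"
  then obtain p where p: "path_between G u v p" "length p = Suc 0"
    using geodesic_exists[OF assms] by metis
  then show "u = v"
    by (cases p) (auto simp: path_between_def)
qed (use assms in auto)

lemma gdist_adj: "adj G u v \<Longrightarrow> gdist G u v \<le> 1"
  using gdist_le[of u v "[u, v]"] adjD[of u v] by (simp add: path_between_def gpath_def)

text \<open>The two pieces of \<open>p\<close> bound the distances from above, and the triangle
  inequality through \<open>p ! n\<close> turns both bounds into equalities.\<close>

lemma gdist_split:
  assumes p: "path_between G u v p" "length p = Suc (gdist G u v)" and "n < length p"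
  shows "p ! n \<in> verts G" "gdist G u (p ! n) = n" "gdist G (p ! n) v = gdist G u v - n"
proof -
  have g: "gpath G p" "hd p = u" "last p = v"
    using p by (auto simp: path_between_def)
  show z: "p ! n \<in> verts G"
    using g \<open>n < length p\<close> by (auto simp: gpath_def)
  have uv: "u \<in> verts G" "v \<in> verts G"
    using g by (auto simp: gpath_def)
  have "p \<noteq> []"
    using \<open>n < length p\<close> by auto
  then have "gpath G (take (Suc n) p)" "gpath G (drop n p)"
    using g \<open>n < length p\<close> gpath_appendD1[of G "take (Suc n) p" "drop (Suc n) p"]
      gpath_appendD2[of G "take n p" "drop n p"] by auto
  moreover have "last (take (Suc n) p) = p ! n"
    using \<open>n < length p\<close> by (simp add: take_Suc_conv_app_nth)
  ultimately have "path_between G u (p ! n) (take (Suc n) p)" "path_between G (p ! n) v (drop n p)"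
    using g \<open>n < length p\<close> unfolding path_between_def by (simp_all add: hd_drop_conv_nth)
  then have "gdist G u (p ! n) \<le> n" "gdist G (p ! n) v \<le> gdist G u v - n"
    using gdist_le[of u "p ! n" "take (Suc n) p"] gdist_le[of "p ! n" v "drop n p"] \<open>n < length p\<close> p(2)
    by simp_all
  moreover have "gdist G u v \<le> gdist G u (p ! n) + gdist G (p ! n) v" "n \<le> gdist G u v"
    using gdist_triangle uv z p(2) \<open>n < length p\<close> by auto
  ultimately show "gdist G u (p ! n) = n" "gdist G (p ! n) v = gdist G u v - n"
    by linarith+
qed

lemma gdist_intermediate:
  assumes "u \<in> verts G" "v \<in> verts G" "n \<le> gdist G u v"
  obtains z where "z \<in> verts G" "gdist G u z = n" "gdist G z v = gdist G u v - n"
proof -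
  obtain p where p: "path_between G u v p" "length p = Suc (gdist G u v)"
    using geodesic_exists[OF assms(1,2)] .
  then show thesis
    using that gdist_split[OF p, of n] assms by simp
qed

lemma geodesic_exists_split:
  assumes "u \<in> verts G" "v \<in> verts G"
  obtains p where "path_between G u v p"
    "\<And>z. z \<in> set p \<Longrightarrow> z \<in> verts G \<and> gdist G u z + gdist G z v = gdist G u v"
proof -
  obtain p where p: "path_between G u v p" "length p = Suc (gdist G u v)"
    using geodesic_exists[OF assms(1,2)] .
  have "z \<in> verts G \<and> gdist G u z + gdist G z v = gdist G u v" if z: "z \<in> set p" for z
  proof -
    obtain n where n: "n < length p" "p ! n = z"
      using z by (auto simp: in_set_conv_nth)
    note z = gdist_split[OF p n(1), unfolded n(2)]
    show ?thesis
      unfolding z using z(1) n(1) p(2) by simp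
  qed
  then show thesis
    using that p(1) by blast
qed

lemma joined_in_geodesic:
  assumes "u \<in> verts G" "v \<in> verts G"
    and "\<And>z. z \<in> verts G \<Longrightarrow> gdist G u z + gdist G z v = gdist G u v \<Longrightarrow> z \<in> S"
  shows "joined_in G S u v"
  by (rule geodesic_exists_split[OF assms(1,2)]) (use assms(3) in \<open>auto simp: joined_in_def\<close>)

lemma le_set_gdist_iff:
  assumes "A \<subseteq> verts G" "B \<subseteq> verts G" "A \<noteq> {}" "B \<noteq> {}"
  shows "K \<le> set_gdist G A B \<longleftrightarrow> (\<forall>x\<in>A. \<forall>y\<in>B. K \<le> gdist G x y)"
proof -
  have eq: "{gdist G x y | x y. x \<in> A \<and> y \<in> B} = (\<lambda>(x, y). gdist G x y) ` (A \<times> B)"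
    by auto
  have "finite (A \<times> B)"
    using assms finite_verts by (meson finite_SigmaI finite_subset)
  then show ?thesis
    unfolding set_gdist_def eq using assms by (subst Min_ge_iff) auto
qed

end

section \<open>Wide triples\<close>

definition far_from :: "'a ugraph \<Rightarrow> nat \<Rightarrow> 'a \<Rightarrow> 'a set" where
  "far_from G K c = {x \<in> verts G. K \<le> gdist G x c}"

definition wide_triple :: "'a ugraph \<Rightarrow> nat \<Rightarrow> 'a \<Rightarrow> 'a \<Rightarrow> 'a \<Rightarrow> bool" where
  "wide_triple G K u v w \<longleftrightarrow>
     joined_in G (far_from G K u) v w \<and> joined_in G (far_from G K v) u w \<and>
     joined_in G (far_from G K w) u v"

lemma wide_triple_antimono: "wide_triple G K u v w \<Longrightarrow> K' \<le> K \<Longrightarrow> wide_triple G K' u v w"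
  unfolding wide_triple_def far_from_def by (auto elim!: joined_in_mono)

lemma wide_triple_verts:
  assumes "wide_triple G K u v w"
  shows "u \<in> verts G" "v \<in> verts G" "w \<in> verts G"
  using assms by (auto simp: wide_triple_def dest: joined_inD)

text \<open>Every tournament on three vertices has a Hamiltonian path, and \<open>b\<close> is its
  middle vertex. With \<open>R\<close> comparing positions along a linear structure, it remains to
  show that a path from \<open>a\<close> to \<open>c\<close> must pass close to
  \<open>b\<close>.\<close>

lemma wide_triple_middle:
  assumes "wide_triple G K u v w"
    and "\<And>x y. x \<in> verts G \<Longrightarrow> y \<in> verts G \<Longrightarrow> R x y \<or> R y x"
  obtains a b c where "a \<in> verts G" "b \<in> verts G" "c \<in> verts G" "R a b" "R b c"
    "joined_in G (far_from G K b) a c" "K \<le> gdist G a c"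
proof -
  note V = wide_triple_verts[OF assms(1)]
  have j: "joined_in G (far_from G K u) v w" "joined_in G (far_from G K v) u w"
     "joined_in G (far_from G K w) u v" "joined_in G (far_from G K u) w v"
     "joined_in G (far_from G K v) w u" "joined_in G (far_from G K w) v u"
    using assms(1) joined_in_sym by (auto simp: wide_triple_def)
  then have d: "K \<le> gdist G v u" "K \<le> gdist G u v" "K \<le> gdist G w u" "K \<le> gdist G u w"
     "K \<le> gdist G v w" "K \<le> gdist G w v"
    by (auto dest!: joined_inD(3) simp: far_from_def)
  have "R u v \<or> R v u" "R u w \<or> R w u" "R v w \<or> R w v"
    using assms(2) V by blast+
  then show thesis
    using that V j d by metis
qed

section \<open>Fat minors yield wide triples\<close>

lemma joined_in_connected_subgraph:
  assumes "connected_subgraph H G" "u \<in> verts H" "v \<in> verts H" "verts H \<subseteq> S"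
  shows "joined_in G S u v"
proof -
  obtain p where p: "path_between H u v p"
    using assms by (meson connected_subgraph_def connected_graph_def)
  moreover have "successively (adj G) q" if "successively (adj H) q" for q
    using that assms(1) by (auto simp: connected_subgraph_def adj_def elim!: successively_mono)
  ultimately have "path_between G u v p"
    using assms(1) by (auto simp: path_between_def gpath_def connected_subgraph_def)
  then show ?thesis
    using p assms(4) unfolding joined_in_def path_between_def gpath_def by blast
qed

lemma joined_in_links:
  assumes H: "connected_subgraph H G" "connected_subgraph H' G" and "links G p H H'"
    and S: "verts H \<subseteq> S" "verts H' \<subseteq> S" "set p \<subseteq> S"
    and uv: "u \<in> verts H" "v \<in> verts H'"
  shows "joined_in G S u v"
proof -
  have p: "gpath G p" "hd p \<in> verts H" "last p \<in> verts H'"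
    using assms(3) by (auto simp: links_def)
  then have "joined_in G S (hd p) (last p)"
    using S unfolding joined_in_def path_between_def by blast
  then show ?thesis
    using joined_in_connected_subgraph[OF H(1) uv(1) p(2) S(1)]
      joined_in_connected_subgraph[OF H(2) p(3) uv(2) S(2)]
    by (blast intro: joined_in_trans)
qed

context conn_graph
begin

lemma subset_far_from:
  assumes "A \<subseteq> verts G" "B \<subseteq> verts G" "K \<le> set_gdist G A B" "b \<in> B"
  shows "A \<subseteq> far_from G K b"
proof (cases "A = {}")
  case False
  then show ?thesis
    using le_set_gdist_iff[of A B K] assms by (auto simp: far_from_def)
qed simp

lemma connected_subgraph_vertsD:
  assumes "connected_subgraph H G"
  shows "verts H \<subseteq> verts G" "verts H \<noteq> {}"
  using assms by (auto simp: connected_subgraph_def connected_graph_def simple_graph_def)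

text \<open>Choose a vertex \<open>c i\<close> in each branch set. A walk inside \<open>H i\<close>,
  along the linking path and inside \<open>H j\<close> keeps distance \<open>K\<close> from
  \<open>H k\<close>, hence from \<open>c k\<close>.\<close>

lemma fat_K3_minor_imp_wide_triple:
  assumes "fat_K3_minor G K"
  shows "\<exists>u v w. wide_triple G K u v w"
proof -
  obtain H P where
    H: "\<forall>i\<in>{1,2,3::nat}. connected_subgraph (H i) G" and
    P: "\<forall>i\<in>{1,2,3}. \<forall>j\<in>{1,2,3}. i < j \<longrightarrow> links G (P i j) (H i) (H j)" and
    HH: "\<forall>i\<in>{1,2,3}. \<forall>j\<in>{1,2,3}. i \<noteq> j \<longrightarrow> K \<le> set_gdist G (verts (H i)) (verts (H j))" and
    PH: "\<forall>i\<in>{1,2,3}. \<forall>j\<in>{1,2,3}. \<forall>k\<in>{1,2,3}. i < j \<longrightarrow> k \<noteq> i \<longrightarrow> k \<noteq> j \<longrightarrow>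
           K \<le> set_gdist G (set (P i j)) (verts (H k))"
    using assms unfolding fat_K3_minor_def by (elim exE conjE)
  have "\<exists>x. x \<in> verts (H i)" if "i \<in> {1,2,3}" for i
    using connected_subgraph_vertsD[of "H i"] H that by blast
  then obtain c where c: "\<And>i. i \<in> {1,2,3} \<Longrightarrow> c i \<in> verts (H i)"
    by metis
  have j: "joined_in G (far_from G K (c k)) (c i) (c j)"
    if ijk: "i \<in> {1,2,3}" "j \<in> {1,2,3}" "k \<in> {1,2,3}" "i < j" "k \<noteq> i" "k \<noteq> j" for i j k
  proof (rule joined_in_links[of "H i" G "H j" "P i j"])
    have Hs: "verts (H i) \<subseteq> verts G" "verts (H j) \<subseteq> verts G" "verts (H k) \<subseteq> verts G"
      using connected_subgraph_vertsD(1) H ijk by blast+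
    show "connected_subgraph (H i) G" "connected_subgraph (H j) G" and
      l: "links G (P i j) (H i) (H j)" and "c i \<in> verts (H i)" "c j \<in> verts (H j)"
      using H P c ijk by blast+
    have "set (P i j) \<subseteq> verts G"
      using l by (auto simp: links_def gpath_def)
    moreover have "K \<le> set_gdist G (verts (H i)) (verts (H k))" "K \<le> set_gdist G (verts (H j)) (verts (H k))"
      "K \<le> set_gdist G (set (P i j)) (verts (H k))"
      using HH[rule_format, OF ijk(1,3)] HH[rule_format, OF ijk(2,3)] PH[rule_format, OF ijk] ijk(5,6)
      by simp_all
    ultimately show "verts (H i) \<subseteq> far_from G K (c k)" "verts (H j) \<subseteq> far_from G K (c k)"
      "set (P i j) \<subseteq> far_from G K (c k)"
      using Hs by (simp_all add: subset_far_from[OF _ Hs(3) _ c[OF ijk(3)]])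
  qed
  have "wide_triple G K (c 1) (c 2) (c 3)"
    unfolding wide_triple_def using j[of 2 3 1] j[of 1 3 2] j[of 1 2 3] by simp
  then show ?thesis
    by blast
qed

lemma fat_K13_minor_imp_wide_triple:
  assumes "fat_K13_minor G K"
  shows "\<exists>u v w. wide_triple G K u v w"
proof -
  obtain H P where
    H: "\<forall>i\<in>{0,1,2,3::nat}. connected_subgraph (H i) G" and
    P: "\<forall>i\<in>{1,2,3}. links G (P i) (H i) (H 0)" and
    HH: "\<forall>i\<in>{0,1,2,3}. \<forall>j\<in>{0,1,2,3}. i \<noteq> j \<longrightarrow> K \<le> set_gdist G (verts (H i)) (verts (H j))" and
    PH: "\<forall>i\<in>{1,2,3}. \<forall>k\<in>{1,2,3}. k \<noteq> i \<longrightarrow> K \<le> set_gdist G (set (P i)) (verts (H k))"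
    using assms unfolding fat_K13_minor_def by (elim exE conjE)
  have "\<exists>x. x \<in> verts (H i)" if "i \<in> {0,1,2,3}" for i
    using connected_subgraph_vertsD[of "H i"] H that by blast
  then obtain c where c: "\<And>i. i \<in> {0,1,2,3} \<Longrightarrow> c i \<in> verts (H i)"
    by metis
  \<comment> \<open>In a claw the leaves are connected only through the centre, so each leg is
    treated separately and two legs are then composed at \<open>c 0\<close>.\<close>
  have j: "joined_in G (far_from G K (c k)) (c i) (c 0)"
    if ik: "i \<in> {1,2,3}" "k \<in> {1,2,3}" "k \<noteq> i" for i k
  proof (rule joined_in_links[of "H i" G "H 0" "P i"])
    have ik': "i \<in> {0,1,2,3}" "k \<in> {0,1,2,3}" "k \<noteq> 0"
      using ik by auto
    have Hs: "verts (H i) \<subseteq> verts G" "verts (H 0) \<subseteq> verts G" "verts (H k) \<subseteq> verts G"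
      using connected_subgraph_vertsD(1) H ik' by blast+
    show "connected_subgraph (H i) G" "connected_subgraph (H 0) G" and
      l: "links G (P i) (H i) (H 0)" and "c i \<in> verts (H i)" "c 0 \<in> verts (H 0)"
      using H P c ik ik' by blast+
    have "set (P i) \<subseteq> verts G"
      using l by (auto simp: links_def gpath_def)
    moreover have "K \<le> set_gdist G (verts (H i)) (verts (H k))" "K \<le> set_gdist G (verts (H 0)) (verts (H k))"
      "K \<le> set_gdist G (set (P i)) (verts (H k))"
      using HH[rule_format, OF ik'(1,2)] HH[rule_format, of 0, OF _ ik'(2)] PH[rule_format, OF ik] ik ik'(3)
      by simp_all
    ultimately show "verts (H i) \<subseteq> far_from G K (c k)" "verts (H 0) \<subseteq> far_from G K (c k)"
      "set (P i) \<subseteq> far_from G K (c k)"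
      using Hs by (simp_all add: subset_far_from[OF _ Hs(3) _ c[OF ik'(2)]])
  qed
  have "joined_in G (far_from G K (c k)) (c i) (c j)"
    if "i \<in> {1,2,3}" "j \<in> {1,2,3}" "k \<in> {1,2,3}" "k \<noteq> i" "k \<noteq> j" for i j k
    using j[of i k] j[of j k] that joined_in_sym joined_in_trans by metis
  then have "wide_triple G K (c 1) (c 2) (c 3)"
    unfolding wide_triple_def by simp
  then show ?thesis
    by blast
qed

section \<open>The diameter, and \<open>mfi\<close> in terms of width\<close>

definition diameter :: nat where
  "diameter = Max ((\<lambda>(x, y). gdist G x y) ` (verts G \<times> verts G))"

lemma gdist_le_diameter: "x \<in> verts G \<Longrightarrow> y \<in> verts G \<Longrightarrow> gdist G x y \<le> diameter"
  unfolding diameter_def using finite_verts by (intro Max_ge) auto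

lemma diameter_attained:
  obtains s t where "s \<in> verts G" "t \<in> verts G" "gdist G s t = diameter"
proof -
  have "diameter \<in> (\<lambda>(x, y). gdist G x y) ` (verts G \<times> verts G)"
    unfolding diameter_def using finite_verts verts_nonempty by (intro Max_in) auto
  then show thesis
    using that by auto
qed

lemma wide_triple_le_diameter: "wide_triple G K u v w \<Longrightarrow> K \<le> diameter"
  using gdist_le_diameter[of v u] wide_triple_verts[of G K u v w]
  by (auto simp: wide_triple_def far_from_def dest!: joined_inD(3))

lemma no_wide_triple_diameter: "\<nexists>u v w. wide_triple G (Suc diameter) u v w"
  using wide_triple_le_diameter by fastforce

text \<open>This gives meaning to the \<open>Max\<close> in \<open>mfi\<close>: the vertices of a
  \<open>K\<close>-wide triple are at least \<open>K\<close> apart.\<close>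

lemma finite_fat_minors: "finite {K. 0 < K \<and> (fat_K3_minor G K \<or> fat_K13_minor G K)}"
proof (rule finite_subset)
  show "{K. 0 < K \<and> (fat_K3_minor G K \<or> fat_K13_minor G K)} \<subseteq> {..diameter}"
    using fat_K3_minor_imp_wide_triple fat_K13_minor_imp_wide_triple wide_triple_le_diameter
    by blast
qed simp

lemma mfi_wide_triple:
  assumes "0 < mfi G"
  shows "\<exists>u v w. wide_triple G (mfi G) u v w"
proof -
  have "mfi G \<in> insert 0 {K. 0 < K \<and> (fat_K3_minor G K \<or> fat_K13_minor G K)}"
    unfolding mfi_def using finite_fat_minors by (intro Max_in) auto
  then show ?thesis
    using assms fat_K3_minor_imp_wide_triple fat_K13_minor_imp_wide_triple by auto
qed

text \<open>The interface for all lower bounds: a parameter is compared with \<open>mfi\<close> by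
  excluding triples wider than a function of that parameter.\<close>

lemma mfi_le:
  assumes "\<nexists>u v w. wide_triple G (Suc m) u v w"
  shows "mfi G \<le> m"
proof (rule ccontr)
  assume "\<not> mfi G \<le> m"
  then show False
    using mfi_wide_triple wide_triple_antimono[of G "mfi G" _ _ _ "Suc m"] assms
    by (metis Suc_leI gr_zeroI not_le zero_le)
qed

lemma le_mfi:
  assumes "fat_K3_minor G K \<or> fat_K13_minor G K"
  shows "K \<le> mfi G"
  unfolding mfi_def using finite_fat_minors assms by (cases "K = 0") (auto intro!: Max_ge)

section \<open>Parameters excluding wide triples\<close>

lemma disk_hits_paths_iff:
  assumes "u \<in> verts G"
  shows "disk_hits_paths G r u v w \<longleftrightarrow> \<not> joined_in G (far_from G (Suc r) u) v w"
proof -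
  have "disk G u r \<inter> set p = {} \<longleftrightarrow> set p \<subseteq> far_from G (Suc r) u" if "path_between G v w p" for p
    using that by (auto simp: disk_def far_from_def path_between_def gpath_def not_le Suc_le_eq)
  then show ?thesis
    unfolding disk_hits_paths_def joined_in_def by blast
qed

lemma wide_triple_distinct:
  assumes "wide_triple G (Suc K) u v w"
  shows "u \<noteq> v" "u \<noteq> w" "v \<noteq> w"
proof -
  have "v \<in> far_from G (Suc K) u" "w \<in> far_from G (Suc K) u" "w \<in> far_from G (Suc K) v"
    using assms by (auto simp: wide_triple_def dest: joined_inD(3,4))
  then show "u \<noteq> v" "u \<noteq> w" "v \<noteq> w"
    by (auto simp: far_from_def)
qed

text \<open>A path misses the disk of radius \<open>r\<close> exactly if it stays at distance at
  least \<open>Suc r\<close> from the centre. So \<open>mci G\<close> is the least \<open>r\<close>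
  without a \<open>Suc r\<close>-wide triple, and its two bounds are minimality and attainment of
  that \<open>LEAST\<close>.\<close>

lemma no_wide_triple_iff:
  "(\<nexists>u v w. wide_triple G (Suc r) u v w) \<longleftrightarrow>
     (\<forall>u\<in>verts G. \<forall>v\<in>verts G. \<forall>w\<in>verts G. u \<noteq> v \<longrightarrow> u \<noteq> w \<longrightarrow> v \<noteq> w \<longrightarrow>
       disk_hits_paths G r u v w \<or> disk_hits_paths G r v u w \<or> disk_hits_paths G r w u v)"
  (is "?L = ?R")
proof
  assume L: ?L
  show ?R
  proof (intro ballI impI)
    fix u v w
    assume "u \<in> verts G" "v \<in> verts G" "w \<in> verts G"
    then show "disk_hits_paths G r u v w \<or> disk_hits_paths G r v u w \<or> disk_hits_paths G r w u v"
      using L by (simp add: disk_hits_paths_iff wide_triple_def)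
  qed
next
  assume R: ?R
  show ?L
  proof (intro notI, elim exE)
    fix u v w
    assume *: "wide_triple G (Suc r) u v w"
    note V = wide_triple_verts[OF *]
    show False
      using R[rule_format, OF V wide_triple_distinct[OF *]] * V
      by (simp add: disk_hits_paths_iff wide_triple_def)
  qed
qed

lemma mci_le: "\<nexists>u v w. wide_triple G (Suc r) u v w \<Longrightarrow> mci G \<le> r"
  unfolding mci_def no_wide_triple_iff by (rule Least_le)

lemma mci_no_wide_triple: "\<nexists>u v w. wide_triple G (Suc (mci G)) u v w"
  unfolding no_wide_triple_iff mci_def
proof (rule LeastI)
  from no_wide_triple_diameter[unfolded no_wide_triple_iff]
  show "\<forall>u\<in>verts G. \<forall>v\<in>verts G. \<forall>w\<in>verts G. u \<noteq> v \<longrightarrow> u \<noteq> w \<longrightarrow> v \<noteq> w \<longrightarrow>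
    disk_hits_paths G diameter u v w \<or> disk_hits_paths G diameter v u w \<or>
    disk_hits_paths G diameter w u v" .
qed

section \<open>Path-decompositions\<close>

lemma gdist_le_decomposition_length:
  assumes "path_decomposition G Xs" "X \<in> set Xs" "u \<in> X" "v \<in> X"
  shows "gdist G u v \<le> decomposition_length G Xs"
proof -
  have "X \<subseteq> verts G" if "X \<in> set Xs" for X
    using assms(1) that unfolding path_decomposition_def by blast
  then have "{gdist G u v | u v. \<exists>X\<in>set Xs. u \<in> X \<and> v \<in> X} \<subseteq> {..diameter}"
    using gdist_le_diameter by fastforce
  then have "finite {gdist G u v | u v. \<exists>X\<in>set Xs. u \<in> X \<and> v \<in> X}"
    by (rule finite_subset) simp
  then show ?thesis
    unfolding decomposition_length_def using assms by (intro Max_ge) auto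
qed

text \<open>A path that stays farther from \<open>b\<close> than the length misses the bag of
  \<open>b\<close>. That bag separates: if \<open>x\<close> lies in an earlier bag and shares a
  later bag with \<open>y\<close>, then convexity puts \<open>x\<close> into the bag of
  \<open>b\<close>.\<close>

lemma path_decomposition_no_wide_triple:
  assumes Xs: "path_decomposition G Xs"
  shows "\<nexists>u v w. wide_triple G (Suc (decomposition_length G Xs)) u v w"
proof (intro notI, elim exE)
  fix u v w
  assume *: "wide_triple G (Suc (decomposition_length G Xs)) u v w"
  have "\<exists>i. i < length Xs \<and> x \<in> Xs ! i" if "x \<in> verts G" for x
    using Xs that unfolding path_decomposition_def by (metis UnionE in_set_conv_nth)
  then obtain f where f: "\<And>x. x \<in> verts G \<Longrightarrow> f x < length Xs \<and> x \<in> Xs ! f x"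
    by metis
  have convex: "x \<in> Xs ! j" if "x \<in> Xs ! i" "x \<in> Xs ! k" "i \<le> j" "j \<le> k" "k < length Xs" for x i j k
    using Xs that unfolding path_decomposition_def by blast
  obtain a b c where abc: "a \<in> verts G" "b \<in> verts G" "c \<in> verts G" "f a \<le> f b" "f b \<le> f c"
    and j: "joined_in G (far_from G (Suc (decomposition_length G Xs)) b) a c"
    by (rule wide_triple_middle[OF *, where R = "\<lambda>x y. f x \<le> f y"]) auto
  have avoid: "x \<notin> Xs ! f b" if "x \<in> far_from G (Suc (decomposition_length G Xs)) b" for x
    using gdist_le_decomposition_length[OF Xs, of "Xs ! f b" x b] f[OF abc(2)] that
    by (auto simp: far_from_def)
  have "\<exists>i\<le>f b. c \<in> Xs ! i"
    using j
  proof (rule joined_in_invariant)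
    show "\<exists>i\<le>f b. a \<in> Xs ! i"
      using abc f by blast
  next
    fix x y
    assume xy: "x \<in> far_from G (Suc (decomposition_length G Xs)) b" "adj G x y" "\<exists>i\<le>f b. x \<in> Xs ! i"
    have "\<exists>X\<in>set Xs. {x, y} \<subseteq> X"
      using Xs xy(2) unfolding path_decomposition_def adj_def by blast
    then obtain m where m: "m < length Xs" "x \<in> Xs ! m" "y \<in> Xs ! m"
      by (auto simp: in_set_conv_nth)
    then show "\<exists>i\<le>f b. y \<in> Xs ! i"
      using xy(3) avoid[OF xy(1)] convex[of x _ m "f b"] by (meson nat_le_linear)
  qed
  then show False
    using avoid[OF joined_inD(4)[OF j]] convex[of c _ "f c" "f b"] f[OF abc(3)] abc(5) by blast
qed

lemma pl_no_wide_triple: "\<nexists>u v w. wide_triple G (Suc (pl G)) u v w"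
proof -
  \<comment> \<open>The one-bag decomposition shows that the minimum in \<open>pl\<close> is
    attained.\<close>
  have "path_decomposition G [verts G]"
    using connected by (auto simp: path_decomposition_def connected_graph_def simple_graph_def)
  then have "\<exists>l Xs. path_decomposition G Xs \<and> decomposition_length G Xs = l"
    by blast
  then have "\<exists>Xs. path_decomposition G Xs \<and> decomposition_length G Xs = pl G"
    unfolding pl_def by (rule LeastI_ex)
  then show ?thesis
    using path_decomposition_no_wide_triple by metis
qed

section \<open>Powers that are AT-free or cocomparability graphs\<close>

lemma adj_graph_power_iff:
  "adj (graph_power G k) x y \<longleftrightarrow> x \<in> verts G \<and> y \<in> verts G \<and> x \<noteq> y \<and> gdist G x y \<le> k"
  unfolding adj_def graph_power_def using gdist_commute by (auto simp: doubleton_eq_iff)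

lemma verts_graph_power [simp]: "verts (graph_power G k) = verts G"
  by (simp add: graph_power_def)

lemma joined_in_graph_power:
  assumes "1 \<le> k" "joined_in G S u v"
  shows "joined_in (graph_power G k) S u v"
proof -
  have "successively (adj (graph_power G k)) p" if "successively (adj G) p" for p
    using that
  proof (rule successively_mono)
    show "adj (graph_power G k) x y" if "adj G x y" for x y
      using that adjD[OF that] gdist_adj[OF that] \<open>1 \<le> k\<close> by (simp add: adj_graph_power_iff)
  qed
  then show ?thesis
    using assms(2) by (auto simp: joined_in_def path_between_def gpath_def)
qed

lemma joined_avoiding_graph_power_iff:
  assumes "w \<in> verts G"
  shows "joined_avoiding (graph_power G k) u v w \<longleftrightarrow>
    joined_in (graph_power G k) (far_from G (Suc k) w) u v"
proof -
  have "closed_nbhd (graph_power G k) w = {x \<in> verts G. gdist G x w \<le> k}"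
    using assms by (auto simp: closed_nbhd_def adj_graph_power_iff)
  then have "set p \<inter> closed_nbhd (graph_power G k) w = {} \<longleftrightarrow> set p \<subseteq> far_from G (Suc k) w"
    if "path_between (graph_power G k) u v p" for p
    using that by (auto simp: far_from_def path_between_def gpath_def)
  then show ?thesis
    unfolding joined_avoiding_def joined_in_def by blast
qed

lemma AT_free_power_no_wide_triple:
  assumes "1 \<le> k" "AT_free (graph_power G k)"
  shows "\<nexists>u v w. wide_triple G (Suc k) u v w"
proof (intro notI, elim exE)
  fix u v w
  assume *: "wide_triple G (Suc k) u v w"
  then have j: "joined_in G (far_from G (Suc k) u) v w" "joined_in G (far_from G (Suc k) v) u w"
    "joined_in G (far_from G (Suc k) w) u v"
    by (auto simp: wide_triple_def)
  have d: "Suc k \<le> gdist G u v" "Suc k \<le> gdist G u w" "Suc k \<le> gdist G v w"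
    using j[THEN joined_inD(3)] j[THEN joined_inD(4)] by (auto simp: far_from_def)
  have "asteroidal_triple (graph_power G k) u v w"
    unfolding asteroidal_triple_def
    using wide_triple_verts[OF *] wide_triple_distinct[OF *] d
      j[THEN joined_in_graph_power[OF assms(1)]]
    by (simp add: adj_graph_power_iff joined_avoiding_graph_power_iff)
  then show False
    using assms(2) by (auto simp: AT_free_def)
qed

text \<open>For \<open>z\<close> on a geodesic from \<open>x\<close> to \<open>y\<close>, the sum of
  two triangle inequalities gives \<open>2 * a \<le> m + 2 * gdist G z w\<close>. The
  \<open>+ 1\<close> in the hypothesis is gained by rounding.\<close>

lemma joined_in_far_from_jump:
  assumes "x \<in> far_from G a w" "y \<in> far_from G a w" "w \<in> verts G"
    and "gdist G x y \<le> m" "m + 2 * b \<le> 2 * a + 1"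
  shows "joined_in G (far_from G b w) x y"
proof (rule joined_in_geodesic)
  show xy: "x \<in> verts G" "y \<in> verts G"
    using assms by (auto simp: far_from_def)
  fix z
  assume z: "z \<in> verts G" "gdist G x z + gdist G z y = gdist G x y"
  have "gdist G x w \<le> gdist G x z + gdist G z w" "gdist G y w \<le> gdist G z y + gdist G z w"
    using gdist_triangle[of _ z w] xy z(1) assms(3) gdist_commute[of z y] by auto
  then show "z \<in> far_from G b w"
    using z assms by (auto simp: far_from_def)
qed

text \<open>Edges of \<open>H\<close> are replaced by geodesics of \<open>G\<close>, which lowers
  the distance to \<open>w\<close> by at most \<open>m / 2\<close>. It serves twice: with a power of
  \<open>G\<close> as \<open>H\<close>, and with a caterpillar as the ambient graph and
  \<open>G\<close> as \<open>H\<close>.\<close>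

lemma joined_in_coarse_far_from:
  assumes "joined_in H (far_from G a w) u v" "w \<in> verts G" "m + 2 * b \<le> 2 * a + 1" "b \<le> a"
    and "\<And>x y. adj H x y \<Longrightarrow> x \<in> far_from G a w \<Longrightarrow> y \<in> far_from G a w \<Longrightarrow> gdist G x y \<le> m"
  shows "joined_in G (far_from G b w) u v"
  using assms(1)
proof (rule joined_in_invariant)
  have "u \<in> far_from G b w"
    using joined_inD(3)[OF assms(1)] \<open>b \<le> a\<close> by (auto simp: far_from_def)
  then show "joined_in G (far_from G b w) u u"
    by (auto intro: joined_in_refl simp: far_from_def)
  show "joined_in G (far_from G b w) u y"
    if "x \<in> far_from G a w" "y \<in> far_from G a w" "adj H x y" "joined_in G (far_from G b w) u x" for x y
    using joined_in_trans[OF that(4) joined_in_far_from_jump[OF that(1,2) assms(2)]] that assms by blast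
qed

text \<open>Avoiding a closed neighbourhood in the power means distance at least
  \<open>2 * r + 2\<close> in \<open>G\<close>, and geodesics of length at most
  \<open>2 * r + 1\<close> between such vertices still keep distance \<open>r + 1\<close>. The
  exponent is positive for \<open>r = 0\<close> too, as \<open>pat\<close> demands.\<close>

lemma no_wide_triple_AT_free_power:
  assumes "\<nexists>u v w. wide_triple G (Suc r) u v w"
  shows "AT_free (graph_power G (2 * r + 1))"
  unfolding AT_free_def
proof (intro notI, elim exE)
  fix u v w
  assume *: "asteroidal_triple (graph_power G (2 * r + 1)) u v w"
  have "joined_in G (far_from G (Suc r) z) x y"
    if "joined_avoiding (graph_power G (2 * r + 1)) x y z" "z \<in> verts G" for x y z
  proof (rule joined_in_coarse_far_from)
    show "joined_in (graph_power G (2 * r + 1)) (far_from G (Suc (2 * r + 1)) z) x y"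
      using that joined_avoiding_graph_power_iff by blast
    show "gdist G x y \<le> 2 * r + 1" if "adj (graph_power G (2 * r + 1)) x y" for x y
      using that by (simp add: adj_graph_power_iff)
  qed (use that in auto)
  then have "wide_triple G (Suc r) u v w"
    using * unfolding asteroidal_triple_def wide_triple_def by simp
  then show False
    using assms by blast
qed

lemma pat_le:
  assumes "\<nexists>u v w. wide_triple G (Suc r) u v w"
  shows "pat G \<le> 2 * r + 1"
  unfolding pat_def using no_wide_triple_AT_free_power[OF assms] by (intro Least_le) auto

lemma pat_no_wide_triple: "\<nexists>u v w. wide_triple G (Suc (pat G)) u v w"
proof -
  have "\<exists>k. 1 \<le> k \<and> AT_free (graph_power G k)"
    using no_wide_triple_AT_free_power[OF no_wide_triple_diameter]
    by (intro exI[of _ "2 * diameter + 1"]) simp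
  then have "1 \<le> pat G \<and> AT_free (graph_power G (pat G))"
    unfolding pat_def by (rule LeastI_ex)
  then show ?thesis
    using AT_free_power_no_wide_triple by blast
qed

text \<open>A path avoiding the disk of radius \<open>k\<close> about \<open>b\<close> cannot pass
  \<open>b\<close> in the ordering: an edge from below \<open>b\<close> to above \<open>b\<close>
  would form a forbidden triple with \<open>b\<close> in the middle.\<close>

lemma cocomparability_power_no_wide_triple:
  assumes "1 \<le> k" "cocomparability (graph_power G k)"
  shows "\<nexists>u v w. wide_triple G (Suc k) u v w"
proof (intro notI, elim exE)
  fix u v w
  assume *: "wide_triple G (Suc k) u v w"
  obtain r where r: "linear_order_on (verts G) r" and
    umbrella: "\<And>x y z. x \<in> verts G \<Longrightarrow> y \<in> verts G \<Longrightarrow> z \<in> verts G \<Longrightarrow>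
      (x, y) \<in> r \<Longrightarrow> x \<noteq> y \<Longrightarrow> (y, z) \<in> r \<Longrightarrow> y \<noteq> z \<Longrightarrow> \<not> adj (graph_power G k) x y \<Longrightarrow>
      \<not> adj (graph_power G k) y z \<Longrightarrow> \<not> adj (graph_power G k) x z"
    using assms(2) unfolding cocomparability_def by auto
  have total: "(x, y) \<in> r \<or> (y, x) \<in> r" if "x \<in> verts G" "y \<in> verts G" for x y
    using r that unfolding linear_order_on_def partial_order_on_def preorder_on_def total_on_def refl_on_def
    by metis
  have antisym: "x = y" if "(x, y) \<in> r" "(y, x) \<in> r" for x y
    using r that unfolding linear_order_on_def partial_order_on_def antisym_def by blast
  obtain a b c where abc: "a \<in> verts G" "b \<in> verts G" "c \<in> verts G" "(a, b) \<in> r" "(b, c) \<in> r"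
    and j: "joined_in G (far_from G (Suc k) b) a c"
    by (rule wide_triple_middle[OF *, where R = "\<lambda>x y. (x, y) \<in> r"]) (use total in auto)
  have far: "x \<noteq> b \<and> \<not> adj (graph_power G k) x b \<and> \<not> adj (graph_power G k) b x"
    if "x \<in> far_from G (Suc k) b" for x
    using that abc(2) gdist_commute[of x b] by (auto simp: far_from_def adj_graph_power_iff)
  have "(c, b) \<in> r"
    using j abc(4)
  proof (rule joined_in_invariant)
    fix x y
    assume xy: "x \<in> far_from G (Suc k) b" "y \<in> far_from G (Suc k) b" "x \<in> verts G" "y \<in> verts G"
      "x \<noteq> y" "adj G x y" "(x, b) \<in> r"
    have "adj (graph_power G k) x y"
      using xy gdist_adj[OF xy(6)] \<open>1 \<le> k\<close> by (simp add: adj_graph_power_iff)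
    then show "(y, b) \<in> r"
      using umbrella[of x b y] total[of b y] xy far[of x] far[of y] abc(2) by blast
  qed
  then show False
    using antisym abc(5) far[OF joined_inD(4)[OF j]] by blast
qed

section \<open>Dominating shortest paths\<close>

lemma path_between_segment:
  assumes "gpath G p" "i \<le> j" "j < length p"
  shows "path_between G (p ! i) (p ! j) (drop i (take (Suc j) p))"
proof -
  have "p \<noteq> []"
    using assms(3) by auto
  then have "gpath G (take (Suc j) p)" "gpath G (drop i (take (Suc j) p))"
    using assms gpath_appendD1[of G "take (Suc j) p" "drop (Suc j) p"]
      gpath_appendD2[of G "take i (take (Suc j) p)" "drop i (take (Suc j) p)",
        unfolded append_take_drop_id] by auto
  moreover have "last (take (Suc j) p) = p ! j"
    using assms by (simp add: take_Suc_conv_app_nth)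
  ultimately show ?thesis
    using assms by (simp add: path_between_def hd_drop_conv_nth)
qed

lemma gdist_shortest_path:
  assumes "shortest_path G p" "i \<le> j" "j < length p"
  shows "gdist G (p ! i) (p ! j) = j - i"
proof -
  have p: "path_between G (hd p) (last p) p" "length p = Suc (gdist G (hd p) (last p))"
    using assms by (auto simp: shortest_path_def path_between_def path_length_def)
  note i = gdist_split[OF p, of i] and j = gdist_split[OF p, of j]
  have g: "gpath G p" "p \<noteq> []" "hd p \<in> verts G" "last p \<in> verts G"
    using p by (auto simp: path_between_def gpath_def)
  have "path_between G (p ! i) (p ! j) (drop i (take (Suc j) p))"
    using path_between_segment[OF g(1)] assms by simp
  then have "gdist G (p ! i) (p ! j) \<le> j - i"
    using gdist_le assms by fastforce
  moreover have "j \<le> i + gdist G (p ! i) (p ! j)"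
    using gdist_triangle[OF g(3) i(1) j(1)] i(2) j(2) assms by simp
  ultimately show ?thesis
    by linarith
qed

text \<open>Of the distance \<open>3 * k + 1\<close> to \<open>b\<close>, moving \<open>b\<close> to
  its projection on \<open>p\<close> costs \<open>k\<close> and moving \<open>x\<close> to its own
  costs another \<open>k\<close>. So the two projections are more than \<open>k\<close> apart, which
  stops a path from jumping over the projection of \<open>b\<close>.\<close>

lemma dominating_shortest_path_no_wide_triple:
  assumes p: "shortest_path G p" "dominating_path G k p"
  shows "\<nexists>u v w. wide_triple G (Suc (3 * k)) u v w"
proof (intro notI, elim exE)
  fix u v w
  assume *: "wide_triple G (Suc (3 * k)) u v w"
  have "\<exists>i<length p. gdist G x (p ! i) \<le> k" if "x \<in> verts G" for x
    using p(2) that unfolding dominating_path_def by (metis in_set_conv_nth)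
  then obtain f where f: "\<And>x. x \<in> verts G \<Longrightarrow> f x < length p \<and> gdist G x (p ! f x) \<le> k"
    by metis
  have pV: "p ! i \<in> verts G" if "i < length p" for i
    using p(2) that nth_mem unfolding dominating_path_def gpath_def by blast
  obtain a b c where abc: "a \<in> verts G" "b \<in> verts G" "c \<in> verts G" "f a \<le> f b" "f b \<le> f c"
    and j: "joined_in G (far_from G (Suc (3 * k)) b) a c"
    by (rule wide_triple_middle[OF *, where R = "\<lambda>x y. f x \<le> f y"]) auto
  let ?z = "p ! f b"
  have avoid: "2 * k < gdist G x ?z" if "x \<in> far_from G (Suc (3 * k)) b" for x
    using gdist_triangle[of x ?z b] gdist_commute[of b ?z] f[OF abc(2)] pV[of "f b"] abc(2) that
    by (auto simp: far_from_def)
  have close: "gdist G x ?z \<le> k + gdist G (p ! i) ?z"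
    if "x \<in> verts G" "i < length p" "gdist G x (p ! i) \<le> k" for x i
    using gdist_triangle[of x "p ! i" ?z] that pV[of i] pV[of "f b"] f[OF abc(2)] by auto
  text \<open>Positions of projections of adjacent vertices differ by at most \<open>2 * k + 1\<close>, so one of any
    two that lie on different sides of \<open>f b\<close> is within \<open>k\<close> of it.\<close>
  have gap: False if x: "x \<in> far_from G (Suc (3 * k)) b" "i \<le> f b" "gdist G x (p ! i) \<le> k"
    and y: "y \<in> far_from G (Suc (3 * k)) b" "f b \<le> i'" "i' < length p" "gdist G y (p ! i') \<le> k"
    and xy: "gdist G x y \<le> 1" for x y i i'
  proof -
    have V: "x \<in> verts G" "y \<in> verts G" "p ! i \<in> verts G" "p ! i' \<in> verts G" "i < length p"
      using x y pV f[OF abc(2)] by (auto simp: far_from_def)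
    have "i' - i \<le> 2 * k + 1"
      using gdist_shortest_path[OF p(1), of i i'] gdist_triangle[OF V(3,1,4)] gdist_triangle[OF V(1,2,4)]
        gdist_commute[OF V(1,3)] x y xy by simp
    moreover have "k < f b - i"
      using avoid[OF x(1)] close[OF V(1,5) x(3)] gdist_shortest_path[OF p(1), of i "f b"] x(2)
        f[OF abc(2)] by simp
    moreover have "k < i' - f b"
      using avoid[OF y(1)] close[OF V(2) y(3,4)] gdist_shortest_path[OF p(1), of "f b" i'] y
        gdist_commute[OF V(4) pV[of "f b"]] f[OF abc(2)] by simp
    ultimately show False
      using x(2) y(2) by linarith
  qed
  have "\<exists>i\<le>f b. gdist G c (p ! i) \<le> k"
    using j
  proof (rule joined_in_invariant)
    show "\<exists>i\<le>f b. gdist G a (p ! i) \<le> k"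
      using f abc by blast
  next
    fix x y
    assume xy: "x \<in> far_from G (Suc (3 * k)) b" "y \<in> far_from G (Suc (3 * k)) b"
      "y \<in> verts G" "adj G x y" "\<exists>i\<le>f b. gdist G x (p ! i) \<le> k"
    then show "\<exists>i\<le>f b. gdist G y (p ! i) \<le> k"
      using gap[of x _ y "f y"] f[of y] gdist_adj[OF xy(4)] by (meson nat_le_linear)
  qed
  \<comment> \<open>The invariant projects \<open>c\<close> to the left of \<open>f b\<close>,
    whereas \<open>f c\<close> lies to the right. As \<open>gap\<close> asks for distance at most 1
    only, it applies with \<open>c\<close> in both places.\<close>
  then show False
    using gap[of c _ c "f c"] joined_inD(4)[OF j] f[OF abc(3)] abc(3,5) by auto
qed

end

section \<open>Wide triples yield fat minors\<close>

lemma third_index: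
  assumes "i \<in> {1,2,3::nat}" "j \<in> {1,2,3}" "i \<noteq> j"
  obtains k where "k \<in> {1,2,3}" "k \<noteq> i" "k \<noteq> j"
    "\<And>l. l \<in> {1,2,3} \<Longrightarrow> l \<noteq> i \<Longrightarrow> l \<noteq> j \<Longrightarrow> l = k"
proof
  \<comment> \<open>The three indices sum to 6.\<close>
  show "6 - i - j \<in> {1,2,3}" "6 - i - j \<noteq> i" "6 - i - j \<noteq> j"
    using assms by auto
  show "l = 6 - i - j" if "l \<in> {1,2,3}" "l \<noteq> i" "l \<noteq> j" for l
    using assms that by auto
qed

text \<open>Two distinct linking paths together touch all three branch sets, so joining them creates
  a hub for a claw.\<close>

lemma index_in_pairs:
  assumes "i \<in> {1,2,3::nat}" "j \<in> {1,2,3}" "i' \<in> {1,2,3}" "j' \<in> {1,2,3}" "i < j" "i' < j'"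
    "(i, j) \<noteq> (i', j')" "l \<in> {1,2,3}"
  shows "l = i \<or> l = j \<or> l = i' \<or> l = j'"
  using assms by auto

definition induced_subgraph :: "'a ugraph \<Rightarrow> 'a set \<Rightarrow> 'a ugraph" where
  "induced_subgraph G S = \<lparr>verts = S, edges = {e \<in> edges G. e \<subseteq> S}\<rparr>"

lemma verts_induced_subgraph [simp]: "verts (induced_subgraph G S) = S"
  by (simp add: induced_subgraph_def)

text \<open>Start at the last vertex in \<open>A\<close> and stop at the first vertex in
  \<open>B\<close> after it. This yields the single intersections that \<open>links\<close>
  demands.\<close>

lemma path_between_trim:
  assumes "joined_in G S a b" "a \<in> A" "b \<in> B" "A \<inter> B = {}"
  obtains x y p where "path_between G x y p" "set p \<subseteq> S" "set p \<inter> A = {x}" "set p \<inter> B = {y}"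
proof -
  obtain p where p: "path_between G a b p" "set p \<subseteq> S"
    using assms(1) by (auto simp: joined_in_def)
  have "\<exists>x\<in>set p. x \<in> A"
    using p(1) assms(2) hd_in_set[of p] unfolding path_between_def gpath_def by blast
  from split_list_last_prop[OF this]
  obtain xs x zs where x: "p = xs @ x # zs" "x \<in> A" "\<forall>z\<in>set zs. z \<notin> A"
    by blast
  have "b \<in> set (x # zs)"
    using p(1) unfolding x(1) path_between_def by auto
  then have "\<exists>y\<in>set zs. y \<in> B"
    using x(2) assms(3,4) by auto
  from split_list_first_prop[OF this]
  obtain ys y ws where y: "zs = ys @ y # ws" "y \<in> B" "\<forall>z\<in>set ys. z \<notin> B"
    by blast
  have "gpath G (x # ys @ [y])"
    using p(1) gpath_appendD2[of G xs "x # ys @ y # ws"] gpath_appendD1[of G "x # ys @ [y]" ws]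
    unfolding x(1) y(1) path_between_def by simp
  then have "path_between G x y (x # ys @ [y])"
    by (simp add: path_between_def)
  moreover have "set (x # ys @ [y]) \<inter> A = {x}" "set (x # ys @ [y]) \<inter> B = {y}"
    using x y assms(4) by auto
  moreover have "set (x # ys @ [y]) \<subseteq> S"
    using p(2) x(1) y(1) by auto
  ultimately show thesis
    using that by blast
qed

context conn_graph
begin

lemma connected_induced_subgraph:
  assumes "S \<subseteq> verts G" "a \<in> S" "\<And>x. x \<in> S \<Longrightarrow> joined_in G S a x"
  shows "connected_subgraph (induced_subgraph G S) G"
proof -
  have "simple_graph (induced_subgraph G S)"
    using connected assms(1,2)
    by (auto simp: simple_graph_def connected_graph_def induced_subgraph_def intro: finite_subset)
  moreover have "\<exists>p. path_between (induced_subgraph G S) x y p" if "x \<in> S" "y \<in> S" for x y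
  proof -
    have "joined_in G S x y"
      using assms(3) that by (meson joined_in_sym joined_in_trans)
    then obtain p where p: "path_between G x y p" "set p \<subseteq> S"
      by (auto simp: joined_in_def)
    have "successively (adj (induced_subgraph G S)) p"
    proof (rule successively_mono)
      show "successively (adj G) p"
        using p(1) by (simp add: path_between_def gpath_def)
      show "adj (induced_subgraph G S) a b" if "a \<in> set p" "b \<in> set p" "adj G a b" for a b
        using that p(2) by (auto simp: adj_def induced_subgraph_def)
    qed
    then have "path_between (induced_subgraph G S) x y p"
      using p by (simp add: path_between_def gpath_def)
    then show ?thesis ..
  qed
  ultimately show ?thesis
    using assms(1) by (auto simp: connected_subgraph_def connected_graph_def induced_subgraph_def)
qed

section \<open>Assembling the minors\<close>

lemma connected_disk:
  assumes "c \<in> verts G"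
  shows "connected_subgraph (induced_subgraph G (disk G c R)) G"
proof (rule connected_induced_subgraph)
  show "disk G c R \<subseteq> verts G" "c \<in> disk G c R"
    using assms by (auto simp: disk_def)
  show "joined_in G (disk G c R) c x" if "x \<in> disk G c R" for x
    using that assms gdist_commute by (intro joined_in_geodesic) (auto simp: disk_def)
qed

text \<open>The centre is the component \<open>C\<close> of \<open>r\<close> inside
  \<open>S\<close>, the other branch sets are the single vertices \<open>c i\<close>, and the legs
  are geodesics of length \<open>t\<close>. Since \<open>C\<close> keeps distance \<open>t\<close>
  from \<open>c i\<close>, the leg meets it in \<open>a i\<close> only. Two legs are at least
  \<open>4 * t - 1 - 2 * t\<close> apart, which is at least \<open>t\<close>.\<close>

lemma fat_K13_minorI:
  assumes t: "1 \<le> t"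
    and c: "\<And>i. i \<in> {1,2,3::nat} \<Longrightarrow> c i \<in> verts G"
    and far: "\<And>i j. i \<in> {1,2,3} \<Longrightarrow> j \<in> {1,2,3} \<Longrightarrow> i \<noteq> j \<Longrightarrow> 4 * t \<le> Suc (gdist G (c i) (c j))"
    and S: "\<And>x i. x \<in> S \<Longrightarrow> i \<in> {1,2,3} \<Longrightarrow> t \<le> gdist G x (c i)"
    and a: "\<And>i. i \<in> {1,2,3} \<Longrightarrow> gdist G (c i) (a i) = t" "\<And>i. i \<in> {1,2,3} \<Longrightarrow> joined_in G S r (a i)"
  shows "fat_K13_minor G t"
proof -
  define C where "C = {x. joined_in G S r x}"
  have C: "C \<subseteq> S" "C \<subseteq> verts G"
    unfolding C_def by (auto dest: joined_inD)
  have r: "r \<in> C"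
    using a(2)[of 1] by (auto simp: C_def intro: joined_in_refl dest: joined_inD)
  have aC: "a i \<in> C" "a i \<in> verts G" if "i \<in> {1,2,3}" for i
    using a(2)[OF that] by (auto simp: C_def dest: joined_inD)
  have joined_C: "joined_in G C r x" if x: "x \<in> C" for x
  proof -
    obtain p where p: "path_between G r x p" "set p \<subseteq> S"
      using x by (auto simp: C_def joined_in_def)
    then have "set p \<subseteq> C"
      using joined_in_path(1)[OF p] by (auto simp: C_def)
    then show ?thesis
      using p(1) by (auto simp: joined_in_def)
  qed
  define H where "H = (\<lambda>i. induced_subgraph G (if i = 0 then C else {c i}))"
  have "\<exists>p. path_between G (c i) (a i) p \<and>
      (\<forall>z\<in>set p. z \<in> verts G \<and> gdist G (c i) z + gdist G z (a i) = t)" if i: "i \<in> {1,2,3}" for i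
    by (rule geodesic_exists_split[OF c[OF i] aC(2)[OF i], unfolded a(1)[OF i]]) blast
  then obtain P where P: "\<And>i. i \<in> {1,2,3} \<Longrightarrow> path_between G (c i) (a i) (P i)"
    and PD: "\<And>i z. i \<in> {1,2,3} \<Longrightarrow> z \<in> set (P i) \<Longrightarrow> z \<in> verts G \<and> gdist G (c i) z + gdist G z (a i) = t"
    by metis
  have PV: "set (P i) \<subseteq> verts G" "set (P i) \<noteq> {}" if "i \<in> {1,2,3}" for i
    using P[OF that] by (auto simp: path_between_def gpath_def)
  have HV: "verts (H 0) = C" "\<And>i. i \<in> {1,2,3} \<Longrightarrow> verts (H i) = {c i}"
    by (auto simp: H_def)
  have conn: "connected_subgraph (H i) G" if "i \<in> {0,1,2,3}" for i
  proof (cases "i = 0")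
    case True
    then show ?thesis
      using connected_induced_subgraph[OF C(2) r joined_C] by (simp add: H_def)
  next
    case False
    then have "c i \<in> verts G"
      using c that by auto
    then show ?thesis
      using False connected_induced_subgraph[of "{c i}" "c i"] by (auto simp: H_def intro: joined_in_refl)
  qed
  have link: "links G (P i) (H i) (H 0)" if i: "i \<in> {1,2,3}" for i
  proof -
    have p: "gpath G (P i)" "hd (P i) = c i" "last (P i) = a i"
      using P[OF i] by (auto simp: path_between_def)
    then have "c i \<in> set (P i)" "a i \<in> set (P i)"
      by (metis gpath_def hd_in_set last_in_set)+
    moreover have "x = a i" if x: "x \<in> set (P i)" "x \<in> C" for x
    proof -
      have "t \<le> gdist G x (c i)" "x \<in> verts G" "gdist G (c i) x + gdist G x (a i) = t"
        using S[of x i] C x i PD[OF i x(1)] by auto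
      then show ?thesis
        using gdist_commute[of x "c i"] gdist_eq_0[of x "a i"] c[OF i] aC(2)[OF i] by simp
    qed
    ultimately have "set (P i) \<inter> C = {a i}" "set (P i) \<inter> {c i} = {c i}"
      using aC[OF i] by blast+
    then show ?thesis
      using p HV i aC[OF i] by (simp add: links_def)
  qed
  have dP: "4 * t \<le> Suc (gdist G x (c k) + t)"
    if "i \<in> {1,2,3}" "k \<in> {1,2,3}" "k \<noteq> i" "x \<in> set (P i)" for i k x
    using far[of i k] that PD[OF that(1,4)] gdist_triangle[of "c i" x "c k"] c[OF that(1)] c[OF that(2)]
    by simp
  have HH0: "t \<le> gdist G x (c i)" "t \<le> gdist G (c i) x" if "x \<in> C" "i \<in> {1,2,3}" for x i
  proof -
    have "x \<in> S" "x \<in> verts G"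
      using C that(1) by blast+
    then show "t \<le> gdist G x (c i)" "t \<le> gdist G (c i) x"
      using S[OF _ that(2)] gdist_commute[OF _ c[OF that(2)]] by metis+
  qed
  have HH: "t \<le> set_gdist G (verts (H i)) (verts (H j))"
    if ij: "i \<in> {0,1,2,3}" "j \<in> {0,1,2,3}" "i \<noteq> j" for i j
  proof -
    have "verts (H l) \<subseteq> verts G \<and> verts (H l) \<noteq> {}" if "l \<in> {0,1,2,3}" for l
      using connected_subgraph_vertsD[OF conn[OF that]] by simp
    moreover have "t \<le> gdist G x y" if xy: "x \<in> verts (H i)" "y \<in> verts (H j)" for x y
    proof -
      consider "i = 0" "j \<in> {1,2,3}" | "j = 0" "i \<in> {1,2,3}" | "i \<in> {1,2,3}" "j \<in> {1,2,3}"
        using ij by blast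
      then show ?thesis
      proof cases
        case 1
        then show ?thesis
          using xy HV(1) HV(2)[OF 1(2)] HH0(1)[OF _ 1(2)] by simp
      next
        case 2
        then show ?thesis
          using xy HV(1) HV(2)[OF 2(2)] HH0(2)[OF _ 2(2)] by simp
      next
        case 3
        have "x = c i" "y = c j"
          using xy HV(2)[OF 3(1)] HV(2)[OF 3(2)] by simp_all
        then show ?thesis
          using far[OF 3 ij(3)] t by simp
      qed
    qed
    ultimately show ?thesis
      using le_set_gdist_iff ij by simp
  qed
  have PH: "t \<le> set_gdist G (set (P i)) (verts (H k))"
    if ik: "i \<in> {1,2,3}" "k \<in> {1,2,3}" "k \<noteq> i" for i k
  proof -
    have "t \<le> gdist G x (c k)" if "x \<in> set (P i)" for x
      using dP[OF ik that] t by linarith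
    then show ?thesis
      using le_set_gdist_iff[OF PV(1)[OF ik(1)], of "{c k}"] PV(2)[OF ik(1)] c[OF ik(2)] HV(2)[OF ik(2)]
      by simp
  qed
  have PP: "t \<le> set_gdist G (set (P i)) (set (P j))"
    if ij: "i \<in> {1,2,3}" "j \<in> {1,2,3}" "i \<noteq> j" for i j
  proof -
    have "t \<le> gdist G x y" if xy: "x \<in> set (P i)" "y \<in> set (P j)" for x y
    proof -
      have "gdist G x (c j) \<le> gdist G x y + gdist G y (c j)" "gdist G y (c j) \<le> t"
        using gdist_triangle[of x y "c j"] gdist_commute[of y "c j"] PD[OF ij(1) xy(1)] PD[OF ij(2) xy(2)]
          c[OF ij(2)] by auto
      then show ?thesis
        using dP[OF ij(1,2) _ xy(1)] ij(3) t by linarith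
    qed
    then show ?thesis
      using le_set_gdist_iff[OF PV(1)[OF ij(1)] PV(1)[OF ij(2)]] PV(2)[OF ij(1)] PV(2)[OF ij(2)] by simp
  qed
  show ?thesis
    unfolding fat_K13_minor_def
    by (rule exI[of _ H], rule exI[of _ P], intro conjI ballI impI) (rule conn link HH PH PP; assumption)+
qed

text \<open>The branch sets are the disks of radius \<open>R\<close> about the \<open>c i\<close>;
  the hypotheses speak of the centres, and each disk involved adds one \<open>R\<close> to the
  required distance.\<close>

lemma fat_K3_minorI:
  assumes c: "\<And>i. i \<in> {1,2,3::nat} \<Longrightarrow> c i \<in> verts G"
    and far: "\<And>i j. i \<in> {1,2,3} \<Longrightarrow> j \<in> {1,2,3} \<Longrightarrow> i \<noteq> j \<Longrightarrow> t + 2 * R \<le> gdist G (c i) (c j)"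
    and P: "\<And>i j. i \<in> {1,2,3} \<Longrightarrow> j \<in> {1,2,3} \<Longrightarrow> i < j \<Longrightarrow> gpath G (P i j) \<and>
      set (P i j) \<inter> disk G (c i) R = {hd (P i j)} \<and> set (P i j) \<inter> disk G (c j) R = {last (P i j)}"
    and PH: "\<And>i j k x. i \<in> {1,2,3} \<Longrightarrow> j \<in> {1,2,3} \<Longrightarrow> k \<in> {1,2,3} \<Longrightarrow> i < j \<Longrightarrow> k \<noteq> i \<Longrightarrow> k \<noteq> j \<Longrightarrow>
      x \<in> set (P i j) \<Longrightarrow> t + R \<le> gdist G x (c k)"
    and PP: "\<And>i j i' j' x y. i \<in> {1,2,3} \<Longrightarrow> j \<in> {1,2,3} \<Longrightarrow> i' \<in> {1,2,3} \<Longrightarrow> j' \<in> {1,2,3} \<Longrightarrow> i < j \<Longrightarrow>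
      i' < j' \<Longrightarrow> (i, j) \<noteq> (i', j') \<Longrightarrow> x \<in> set (P i j) \<Longrightarrow> y \<in> set (P i' j') \<Longrightarrow> t \<le> gdist G x y"
  shows "fat_K3_minor G t"
proof -
  define H where "H = (\<lambda>i. induced_subgraph G (disk G (c i) R))"
  have HV: "verts (H i) = disk G (c i) R" for i
    by (simp add: H_def)
  have conn: "connected_subgraph (H i) G" if "i \<in> {1,2,3}" for i
    using connected_disk c[OF that] by (simp add: H_def)
  have link: "links G (P i j) (H i) (H j)" if "i \<in> {1,2,3}" "j \<in> {1,2,3}" "i < j" for i j
    using P[OF that] by (auto simp: links_def HV)
  have PV: "set (P i j) \<subseteq> verts G" "set (P i j) \<noteq> {}" if "i \<in> {1,2,3}" "j \<in> {1,2,3}" "i < j" for i j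
    using P[OF that] by (auto simp: gpath_def)
  have diskV: "disk G (c i) R \<subseteq> verts G" "disk G (c i) R \<noteq> {}" if "i \<in> {1,2,3}" for i
    using c[OF that] by (auto simp: disk_def)
  have HH: "t \<le> set_gdist G (verts (H i)) (verts (H j))"
    if ij: "i \<in> {1,2,3}" "j \<in> {1,2,3}" "i \<noteq> j" for i j
  proof -
    have "t \<le> gdist G x y" if "x \<in> disk G (c i) R" "y \<in> disk G (c j) R" for x y
    proof -
      have x: "x \<in> verts G" "gdist G x (c i) \<le> R" and y: "y \<in> verts G" "gdist G y (c j) \<le> R"
        using that by (auto simp: disk_def)
      show ?thesis
        using far[OF ij] gdist_triangle[OF c[OF ij(1)] x(1) c[OF ij(2)]]
          gdist_triangle[OF x(1) y(1) c[OF ij(2)]] gdist_commute[OF x(1) c[OF ij(1)]] x y by linarith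
    qed
    then show ?thesis
      using le_set_gdist_iff diskV ij HV by simp
  qed
  have PH': "t \<le> set_gdist G (set (P i j)) (verts (H k))"
    if ijk: "i \<in> {1,2,3}" "j \<in> {1,2,3}" "k \<in> {1,2,3}" "i < j" "k \<noteq> i" "k \<noteq> j" for i j k
  proof -
    have "t \<le> gdist G x y" if "x \<in> set (P i j)" "y \<in> disk G (c k) R" for x y
    proof -
      have x: "x \<in> verts G" and y: "y \<in> verts G" "gdist G y (c k) \<le> R"
        using that PV[OF ijk(1,2,4)] by (auto simp: disk_def)
      show ?thesis
        using PH[OF ijk that(1)] gdist_triangle[OF x(1) y(1) c[OF ijk(3)]] y by linarith
    qed
    then show ?thesis
      using le_set_gdist_iff diskV PV ijk HV by simp
  qed
  have PP': "t \<le> set_gdist G (set (P i j)) (set (P i' j'))"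
    if *: "i \<in> {1,2,3}" "j \<in> {1,2,3}" "i' \<in> {1,2,3}" "j' \<in> {1,2,3}" "i < j" "i' < j'" "(i, j) \<noteq> (i', j')"
    for i j i' j'
    using le_set_gdist_iff[OF PV(1)[OF *(1,2,5)] PV(1)[OF *(3,4,6)]] PV(2)[OF *(1,2,5)] PV(2)[OF *(3,4,6)]
      PP[OF *] by simp
  show ?thesis
    unfolding fat_K3_minor_def
    by (rule exI[of _ H], rule exI[of _ P], intro conjI ballI impI) (rule conn link HH PH' PP'; assumption)+
qed

text \<open>The vertex after \<open>x\<close> is already outside the disk, so \<open>x\<close> lies
  on its boundary.\<close>

lemma gdist_path_leaving_disk:
  assumes p: "path_between G x y p" "set p \<inter> disk G c R = {x}" "x \<noteq> y" and c: "c \<in> verts G"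
  shows "R \<le> gdist G x c"
proof -
  obtain z q where p': "p = x # z # q"
    using p by (cases p; cases "tl p") (auto simp: path_between_def gpath_def)
  have xz: "adj G x z" "x \<noteq> z"
    using p(1) unfolding p' path_between_def gpath_def by auto
  then have "z \<notin> disk G c R"
    using p(2) unfolding p' by auto
  then have "R < gdist G z c"
    using adjD[OF xz(1)] by (auto simp: disk_def)
  then show ?thesis
    using gdist_triangle[of z x c] gdist_adj[OF xz(1)] gdist_commute[of x z] adjD[OF xz(1)] c by simp
qed

text \<open>A claw appears as soon as the three paths meet in one component outside the balls of radius
  \<open>t - 1\<close>. Otherwise the parts of the paths outside larger balls of radius \<open>R\<close> can only be linked
  through a smaller ball, so they are at distance at least \<open>2 * (R - t + 1) \<ge> t\<close>.\<close>

theorem wide_triple_imp_fat_minor: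
  assumes t: "1 \<le> t" and wide: "wide_triple G (4 * t - 1) u v w"
  shows "fat_K3_minor G t \<or> fat_K13_minor G t"
proof (rule disjCI)
  assume no_claw: "\<not> fat_K13_minor G t"
  \<comment> \<open>\<open>R = t + h\<close> is the only integer with
    \<open>3 * t - 2 \<le> 2 * R \<le> 3 * t - 1\<close>. The upper bound keeps the disks, and each
    path and the third disk, at distance \<open>t\<close>; the lower bound is for two paths that
    come close to each other.\<close>
  define h where "h = (t - 1) div 2"
  define R where "R = t + h"
  have "2 * h \<le> t - 1" "t - 1 \<le> 2 * h + 1"
    unfolding h_def by presburger+
  then have R: "t \<le> R" "2 * R \<le> 3 * t - 1" "t \<le> 2 * (R + 1 - t)"
    using t unfolding R_def by auto
  define c where "c = (\<lambda>i::nat. if i = 1 then u else if i = 2 then v else w)"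
  have c: "c i \<in> verts G" for i
    using wide_triple_verts[OF wide] by (simp add: c_def)
  have "joined_in G (far_from G (4 * t - 1) (c 1)) (c 2) (c 3)"
    "joined_in G (far_from G (4 * t - 1) (c 2)) (c 1) (c 3)"
    "joined_in G (far_from G (4 * t - 1) (c 3)) (c 1) (c 2)"
    using wide by (auto simp: wide_triple_def c_def)
  then have J: "joined_in G (far_from G (4 * t - 1) (c k)) (c i) (c j)"
    if "i \<in> {1,2,3}" "j \<in> {1,2,3}" "k \<in> {1,2,3}" "i \<noteq> j" "k \<noteq> i" "k \<noteq> j" for i j k
    using that joined_in_sym by auto
  have far: "4 * t - 1 \<le> gdist G (c i) (c j)" if ij: "i \<in> {1,2,3}" "j \<in> {1,2,3}" "i \<noteq> j" for i j
  proof -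
    obtain k where k: "k \<in> {1,2,3}" "k \<noteq> i" "k \<noteq> j"
      using third_index[OF ij] .
    have "c i \<in> far_from G (4 * t - 1) (c j)"
      using joined_inD(3)[OF J[OF ij(1) k(1) ij(2)]] ij(3) k by blast
    then show ?thesis
      by (simp add: far_from_def)
  qed
  define S where "S = {x \<in> verts G. \<forall>i\<in>{1,2,3}. t \<le> gdist G x (c i)}"
  \<comment> \<open>A component of \<open>S\<close> that comes within \<open>R\<close> of every
    \<open>c i\<close> is the centre of a claw. From \<open>b\<close>, a geodesic towards
    \<open>c i\<close> is followed down to distance \<open>t\<close>; it remains in \<open>S\<close>
    because the other two vertices are at least \<open>4 * t - 1 - R\<close> away.\<close>
  have no_hub: False if hub: "\<And>i. i \<in> {1,2,3} \<Longrightarrow> \<exists>b. joined_in G S r b \<and> gdist G b (c i) \<le> R" for r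
  proof -
    have "\<exists>a. gdist G (c i) a = t \<and> joined_in G S r a" if i: "i \<in> {1,2,3}" for i
    proof -
      obtain b where b: "joined_in G S r b" "gdist G b (c i) \<le> R"
        using hub[OF i] by blast
      have bV: "b \<in> verts G" "t \<le> gdist G b (c i)"
        using joined_inD[OF b(1)] i by (auto simp: S_def)
      then obtain a where a: "a \<in> verts G" "gdist G (c i) a = t" "gdist G a b = gdist G (c i) b - t"
        using gdist_intermediate[of "c i" b t] c gdist_commute[of b "c i"] by metis
      have ba: "joined_in G S b a"
      proof (rule joined_in_geodesic[OF bV(1) a(1)])
        fix z
        assume z: "z \<in> verts G" "gdist G b z + gdist G z a = gdist G b a"
        have zi: "t \<le> gdist G z (c i)" "gdist G z (c i) \<le> R"
          using gdist_triangle[OF bV(1) z(1) c[of i]] gdist_triangle[OF z(1) a(1) c[of i]] z a b bV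
            gdist_commute[OF bV(1) c[of i]] gdist_commute[OF a(1) c[of i]] gdist_commute[OF a(1) bV(1)]
          by linarith+
        have "t \<le> gdist G z (c j)" if "j \<in> {1,2,3}" for j
        proof (cases "j = i")
          case False
          show ?thesis
            using far[OF i that] False gdist_triangle[OF c[of i] z(1) c[of j]] zi(2)
              gdist_commute[OF z(1) c[of i]] R(2) t by linarith
        qed (use zi in simp)
        then show "z \<in> S"
          using z(1) by (simp add: S_def)
      qed
      then show ?thesis
        using a(2) joined_in_trans[OF b(1) ba] by blast
    qed
    then obtain a where a: "\<And>i. i \<in> {1,2,3} \<Longrightarrow> gdist G (c i) (a i) = t"
      "\<And>i. i \<in> {1,2,3} \<Longrightarrow> joined_in G S r (a i)"
      by metis
    have "fat_K13_minor G t"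
    proof (rule fat_K13_minorI[OF t c _ _ a])
      show "4 * t \<le> Suc (gdist G (c i) (c j))" if "i \<in> {1,2,3}" "j \<in> {1,2,3}" "i \<noteq> j" for i j
        using far[OF that] by linarith
      show "t \<le> gdist G x (c i)" if "x \<in> S" "i \<in> {1,2,3}" for x i
        using that unfolding S_def by blast
    qed
    then show False
      using no_claw by contradiction
  qed
  \<comment> \<open>The path runs from boundary to boundary of its two disks, so all of it is at
    distance at least \<open>R\<close> from all three centres.\<close>
  define Q where "Q i j p \<longleftrightarrow> gpath G p \<and> set p \<inter> disk G (c i) R = {hd p} \<and>
      set p \<inter> disk G (c j) R = {last p} \<and>
      (\<forall>x\<in>set p. R \<le> gdist G x (c i) \<and> R \<le> gdist G x (c j) \<and>
        (\<forall>k\<in>{1,2,3}. k \<noteq> i \<longrightarrow> k \<noteq> j \<longrightarrow> 4 * t - 1 \<le> gdist G x (c k)))" for i j p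
  have "\<exists>p. Q i j p"
    if ij: "i \<in> {1,2,3}" "j \<in> {1,2,3}" "i < j" for i j
  proof -
    have disj: "disk G (c i) R \<inter> disk G (c j) R = {}"
    proof -
      have False if x: "x \<in> verts G" "gdist G x (c i) \<le> R" "gdist G x (c j) \<le> R" for x
        using far[OF ij(1,2)] ij(3) gdist_triangle[OF c[of i] x(1) c[of j]] gdist_commute[OF x(1) c[of i]]
          x R(2) t by linarith
      then show ?thesis
        by (auto simp: disk_def)
    qed
    obtain k where k: "k \<in> {1,2,3}" "k \<noteq> i" "k \<noteq> j"
      and k_eq: "\<And>l. l \<in> {1,2,3} \<Longrightarrow> l \<noteq> i \<Longrightarrow> l \<noteq> j \<Longrightarrow> l = k"
      by (rule third_index[OF ij(1,2) less_imp_neq[OF ij(3)]]) blast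
    have ends: "c i \<in> disk G (c i) R" "c j \<in> disk G (c j) R"
      using c by (auto simp: disk_def)
    obtain x y p where p: "path_between G x y p" "set p \<subseteq> far_from G (4 * t - 1) (c k)"
      "set p \<inter> disk G (c i) R = {x}" "set p \<inter> disk G (c j) R = {y}"
      using path_between_trim[OF J[OF ij(1,2) k(1) less_imp_neq[OF ij(3)] k(2,3)] ends disj] .
    have xy: "x \<noteq> y" "x \<in> set p" "y \<in> set p"
      using p(3,4) disj by auto
    have end_x: "R \<le> gdist G x (c i)"
      using gdist_path_leaving_disk[OF p(1,3) xy(1)] c by simp
    have end_y: "R \<le> gdist G y (c j)"
      using gdist_path_leaving_disk[OF path_between_rev[OF p(1)], of "c j" R] p(4) xy(1) c by simp
    have pV: "set p \<subseteq> verts G"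
      using p(1) by (auto simp: path_between_def gpath_def)
    have "R \<le> gdist G z (c i)" if "z \<in> set p" for z
      using p(3) end_x that pV by (cases "z = x") (auto simp: disk_def)
    moreover have "R \<le> gdist G z (c j)" if "z \<in> set p" for z
      using p(4) end_y that pV by (cases "z = y") (auto simp: disk_def)
    moreover have "4 * t - 1 \<le> gdist G z (c l)"
      if "z \<in> set p" "l \<in> {1,2,3}" "l \<noteq> i" "l \<noteq> j" for z l
      using that(1) p(2) k_eq[OF that(2-)] by (auto simp: far_from_def)
    moreover have "gpath G p" "hd p = x" "last p = y"
      using p(1) by (auto simp: path_between_def)
    ultimately show ?thesis
      unfolding Q_def using p(3,4) by blast
  qed
  then obtain P where P: "\<And>i j. i \<in> {1,2,3} \<Longrightarrow> j \<in> {1,2,3} \<Longrightarrow> i < j \<Longrightarrow> Q i j (P i j)"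
    by metis
  have P1: "gpath G (P i j)" "set (P i j) \<inter> disk G (c i) R = {hd (P i j)}"
      "set (P i j) \<inter> disk G (c j) R = {last (P i j)}"
    and P2: "\<And>x k. x \<in> set (P i j) \<Longrightarrow> k \<in> {1,2,3} \<Longrightarrow> k \<noteq> i \<Longrightarrow> k \<noteq> j \<Longrightarrow> 4 * t - 1 \<le> gdist G x (c k)"
    and P3: "\<And>x k. x \<in> set (P i j) \<Longrightarrow> k \<in> {1,2,3} \<Longrightarrow> R \<le> gdist G x (c k)"
    if ij: "i \<in> {1,2,3}" "j \<in> {1,2,3}" "i < j" for i j
  proof -
    note P' = P[OF ij, unfolded Q_def]
    show "gpath G (P i j)" "set (P i j) \<inter> disk G (c i) R = {hd (P i j)}"
      "set (P i j) \<inter> disk G (c j) R = {last (P i j)}"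
      using P' by blast+
    show P2: "4 * t - 1 \<le> gdist G x (c k)" if "x \<in> set (P i j)" "k \<in> {1,2,3}" "k \<noteq> i" "k \<noteq> j" for x k
      using P' that by blast
    show "R \<le> gdist G x (c k)" if "x \<in> set (P i j)" "k \<in> {1,2,3}" for x k
    proof (cases "k = i \<or> k = j")
      case True
      then show ?thesis
        using P' that by blast
    next
      case False
      then have "4 * t - 1 \<le> gdist G x (c k)"
        using P2[of x k] that by blast
      then show ?thesis
        using R(2) t by linarith
    qed
  qed
  have PV: "set (P i j) \<subseteq> verts G" if "i \<in> {1,2,3}" "j \<in> {1,2,3}" "i < j" for i j
    using P1(1)[OF that] by (simp add: gpath_def)
  have PS: "set (P i j) \<subseteq> S" if ij: "i \<in> {1,2,3}" "j \<in> {1,2,3}" "i < j" for i j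
    using P3[OF ij] PV[OF ij] R(1) unfolding S_def by (blast intro: order_trans)
  have reach: "\<exists>b. joined_in G S x b \<and> gdist G b (c l) \<le> R"
    if ij: "i \<in> {1,2,3}" "j \<in> {1,2,3}" "i < j" and "x \<in> set (P i j)" "l = i \<or> l = j" for i j x l
  proof -
    have pb: "path_between G (hd (P i j)) (last (P i j)) (P i j)"
      using P1(1)[OF ij] by (simp add: path_between_def)
    have "gdist G (hd (P i j)) (c i) \<le> R" "gdist G (last (P i j)) (c j) \<le> R"
      using P1(2,3)[OF ij] by (auto simp: disk_def)
    moreover have "joined_in G S x (hd (P i j))" "joined_in G S x (last (P i j))"
      using joined_in_path(1)[OF pb PS[OF ij] that(4), THEN joined_in_sym]
        joined_in_path(2)[OF pb PS[OF ij] that(4)] by simp_all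
    ultimately show ?thesis
      using that(5) by blast
  qed
  show "fat_K3_minor G t"
  proof (rule fat_K3_minorI[of c t R P])
    show "c i \<in> verts G" for i
      by (rule c)
    show "t + 2 * R \<le> gdist G (c i) (c j)" if "i \<in> {1,2,3}" "j \<in> {1,2,3}" "i \<noteq> j" for i j
      using far[OF that] R(2) t by linarith
    show "gpath G (P i j) \<and> set (P i j) \<inter> disk G (c i) R = {hd (P i j)} \<and>
        set (P i j) \<inter> disk G (c j) R = {last (P i j)}"
      if "i \<in> {1,2,3}" "j \<in> {1,2,3}" "i < j" for i j
      using P1[OF that] by blast
    show "t + R \<le> gdist G x (c k)"
      if "i \<in> {1,2,3}" "j \<in> {1,2,3}" "k \<in> {1,2,3}" "i < j" "k \<noteq> i" "k \<noteq> j" "x \<in> set (P i j)" for i j k x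
      using P2[OF that(1,2,4,7,3,5,6)] R(2) t by linarith
    show "t \<le> gdist G x y"
      if ij: "i \<in> {1,2,3}" "j \<in> {1,2,3}" and ij': "i' \<in> {1,2,3}" "j' \<in> {1,2,3}" and less: "i < j" "i' < j'"
        and ne: "(i, j) \<noteq> (i', j')" and x: "x \<in> set (P i j)" and y: "y \<in> set (P i' j')" for i j i' j' x y
    proof (rule ccontr)
      assume "\<not> t \<le> gdist G x y"
      then have xy: "gdist G x y < t"
        by simp
      have V: "x \<in> verts G" "y \<in> verts G"
        using PV[OF ij less(1)] PV[OF ij' less(2)] x y by blast+
      \<comment> \<open>Both ends are at least \<open>R\<close> from each centre and at most
        \<open>t - 1\<close> apart, so twice the distance of a vertex between them from a centre is
        at least \<open>2 * R - (t - 1)\<close>, hence at least \<open>2 * t - 1\<close>. The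
        geodesic therefore lies in \<open>S\<close> and links the two paths, which makes
        \<open>x\<close> a hub.\<close>
      have joined_xy: "joined_in G S x y"
      proof (rule joined_in_geodesic[OF V])
        fix z
        assume z: "z \<in> verts G" "gdist G x z + gdist G z y = gdist G x y"
        have "t \<le> gdist G z (c l)" if l: "l \<in> {1,2,3}" for l
          using P3[OF ij less(1) x l] P3[OF ij' less(2) y l] gdist_triangle[OF V(1) z(1) c[of l]]
            gdist_triangle[OF V(2) z(1) c[of l]] gdist_commute[OF V(2) z(1)] z(2) xy R(3) by linarith
        then show "z \<in> S"
          using z(1) by (simp add: S_def)
      qed
      have "\<exists>b. joined_in G S x b \<and> gdist G b (c l) \<le> R" if "l = i' \<or> l = j'" for l
        using reach[OF ij' less(2) y that] joined_in_trans[OF joined_xy] by blast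
      moreover have "l = i \<or> l = j \<or> l = i' \<or> l = j'" if "l \<in> {1,2,3}" for l
        using index_in_pairs[OF ij ij' less ne that] .
      ultimately show False
        using no_hub[of x] reach[OF ij less(1) x] by blast
    qed
  qed
qed

lemma mfi_no_wide_triple: "\<nexists>u v w. wide_triple G (4 * mfi G + 3) u v w"
proof (intro notI, elim exE)
  fix u v w
  assume *: "wide_triple G (4 * mfi G + 3) u v w"
  then have "fat_K3_minor G (Suc (mfi G)) \<or> fat_K13_minor G (Suc (mfi G))"
    by (intro wide_triple_imp_fat_minor) (auto simp: algebra_simps)
  then show False
    using le_mfi by fastforce
qed

end

section \<open>Upper bounds in the absence of wide triples\<close>

context conn_graph
begin

text \<open>A geodesic between the vertices of a dominating pair is a dominating shortest path. The
  pair \<open>x\<close>, \<open>x\<close> with \<open>diameter\<close> shows that the minimum in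
  \<open>dpr\<close> is attained.\<close>

lemma dsp_le_dpr: "dsp G \<le> dpr G"
proof -
  obtain x where x: "x \<in> verts G"
    using verts_nonempty by blast
  have "dominating_path G diameter p" if "path_between G x x p" for p
  proof -
    have "gpath G p" "x \<in> set p"
      using that by (auto simp: path_between_def gpath_def)
    then show ?thesis
      using gdist_le_diameter x unfolding dominating_path_def by blast
  qed
  then have "dominating_pair G diameter x x"
    using x by (simp add: dominating_pair_def)
  then have "\<exists>k x y. dominating_pair G k x y"
    by blast
  then have "\<exists>x y. dominating_pair G (dpr G) x y"
    unfolding dpr_def by (rule LeastI_ex)
  then obtain x y where xy: "dominating_pair G (dpr G) x y"
    by blast
  then obtain p where p: "path_between G x y p" "length p = Suc (gdist G x y)"
    using geodesic_exists[of x y] unfolding dominating_pair_def by blast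
  then have "shortest_path G p" "dominating_path G (dpr G) p"
    using xy by (auto simp: shortest_path_def path_between_def path_length_def dominating_pair_def)
  then show ?thesis
    unfolding dsp_def by (intro Least_le) blast
qed

lemma dsp_no_wide_triple: "\<nexists>u v w. wide_triple G (Suc (3 * dsp G)) u v w"
proof -
  obtain x where x: "x \<in> verts G"
    using verts_nonempty by blast
  have "shortest_path G [x]" "dominating_path G diameter [x]"
    using x gdist_le_diameter
    by (auto simp: shortest_path_def gpath_def path_length_def dominating_path_def)
  then have "\<exists>k p. shortest_path G p \<and> dominating_path G k p"
    by blast
  then have "\<exists>p. shortest_path G p \<and> dominating_path G (dsp G) p"
    unfolding dsp_def by (rule LeastI_ex)
  then show ?thesis
    using dominating_shortest_path_no_wide_triple by blast
qed

text \<open>Some geodesic from \<open>u\<close> to \<open>v\<close> comes within \<open>r\<close> of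
  \<open>c\<close>, and going from there to \<open>c\<close> and back adds at most
  \<open>2 * r\<close>.\<close>

lemma gdist_le_if_not_joined:
  assumes "\<not> joined_in G (far_from G (Suc r) c) u v"
    and V: "u \<in> verts G" "v \<in> verts G" "c \<in> verts G"
  shows "gdist G u c + gdist G c v \<le> gdist G u v + 2 * r"
proof -
  obtain z where z: "z \<in> verts G" "gdist G u z + gdist G z v = gdist G u v" "z \<notin> far_from G (Suc r) c"
    using joined_in_geodesic[OF V(1,2)] assms(1) by blast
  then have "gdist G z c \<le> r"
    by (simp add: far_from_def)
  then show ?thesis
    using gdist_triangle[OF V(1) z(1) V(3)] gdist_triangle[OF V(3) z(1) V(2)]
      gdist_commute[OF z(1) V(3)] z(2) by linarith
qed

text \<open>A discrete intermediate value theorem: along a geodesic from \<open>x\<close> to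
  \<open>z\<close>, the distance from \<open>s\<close> changes by at most 1 per step.\<close>

lemma gdist_layer:
  assumes "s \<in> verts G" "x \<in> verts G" "z \<in> verts G" "gdist G s x \<le> m" "m \<le> gdist G s z"
  obtains y where "y \<in> verts G" "gdist G s y = m" "gdist G x y + gdist G y z = gdist G x z"
proof -
  define S where "S = {y \<in> verts G. gdist G x y + gdist G y z = gdist G x z}"
  have "\<exists>y\<in>S. gdist G s y = m"
  proof (rule ccontr)
    assume no: "\<not> (\<exists>y\<in>S. gdist G s y = m)"
    have j: "joined_in G S x z"
      using assms by (intro joined_in_geodesic) (auto simp: S_def)
    moreover have "gdist G s x < m"
      using no joined_inD(3)[OF j] assms(4) le_neq_implies_less by blast
    ultimately have "gdist G s z < m"
    proof (rule joined_in_invariant)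
      fix a b
      assume ab: "b \<in> S" "a \<in> verts G" "b \<in> verts G" "adj G a b" "gdist G s a < m"
      have "gdist G s b \<le> m"
        using gdist_triangle[OF assms(1) ab(2,3)] gdist_adj[OF ab(4)] ab(5) by linarith
      then show "gdist G s b < m"
        using no ab(1) le_neq_implies_less by blast
    qed
    then show False
      using assms(5) by simp
  qed
  then show thesis
    using that by (auto simp: S_def)
qed

end

text \<open>The locale is used with \<open>r = 4 * mfi G + 2\<close> for the upper bounds, and with
  \<open>r = diameter\<close>, which every graph satisfies, to see that the minimum in
  \<open>pcc\<close> is attained.\<close>

locale narrow_graph = conn_graph +
  fixes r :: nat and s t :: 'a
  assumes narrow: "\<nexists>u v w. wide_triple G (Suc r) u v w"
    and s: "s \<in> verts G" and t: "t \<in> verts G" and diametral: "gdist G s t = diameter"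
begin

text \<open>If \<open>u\<close> and \<open>v\<close> are far apart, then the disk of radius \<open>r\<close> around \<open>s\<close> separates them, hence
  separates one of them from \<open>t\<close>. As \<open>t\<close> is farthest from \<open>s\<close> and realises the diameter, that
  one is close to \<open>s\<close>.\<close>

lemma same_layer_close:
  assumes uv: "u \<in> verts G" "v \<in> verts G" "gdist G s u = gdist G s v"
  shows "gdist G u v \<le> 2 * r \<or> gdist G s u \<le> 2 * r"
proof -
  consider "\<not> joined_in G (far_from G (Suc r) u) s v" | "\<not> joined_in G (far_from G (Suc r) v) s u" |
    "\<not> joined_in G (far_from G (Suc r) s) u v"
    using narrow unfolding wide_triple_def by blast
  then show ?thesis
  proof cases
    case 1
    then show ?thesis
      using gdist_le_if_not_joined[OF 1 s uv(2,1)] uv(3) by simp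
  next
    case 2
    then show ?thesis
      using gdist_le_if_not_joined[OF 2 s uv(1,2)] uv gdist_commute[of u v] by simp
  next
    case 3
    have close: "gdist G s x \<le> 2 * r" if "\<not> joined_in G (far_from G (Suc r) s) x t" "x \<in> verts G" for x
      using gdist_le_if_not_joined[OF that t s] gdist_le_diameter[OF that(2) t] diametral
        gdist_commute[OF that(2) s] by linarith
    have "\<not> joined_in G (far_from G (Suc r) s) u t \<or> \<not> joined_in G (far_from G (Suc r) s) v t"
      using 3 joined_in_sym[of G _ v t] joined_in_trans[of G _ u t v] by blast
    then show ?thesis
      using close[of u] close[of v] uv by auto
  qed
qed

lemma same_layer_le:
  assumes "u \<in> verts G" "v \<in> verts G" "gdist G s u = gdist G s v"
  shows "gdist G u v \<le> 4 * r"
  using same_layer_close[OF assms] gdist_triangle[OF assms(1) s assms(2)] gdist_commute[OF s assms(1)]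
    assms(3) by linarith

text \<open>If the disk about \<open>s\<close> separates \<open>v\<close> from \<open>t\<close>,
  then \<open>v\<close> is within \<open>2 * r\<close> of \<open>s\<close>, since \<open>v\<close>
  is no farther from \<open>t\<close> than \<open>s\<close> is; the same holds with \<open>s\<close>
  and \<open>t\<close> exchanged. Otherwise the disk about \<open>v\<close> meets every path from
  \<open>s\<close> to \<open>t\<close>.\<close>

lemma dominating_pair_diametral: "dominating_pair G (2 * r) s t"
proof -
  have "\<exists>x\<in>set p. gdist G v x \<le> 2 * r" if p: "path_between G s t p" and v: "v \<in> verts G" for p v
  proof -
    have st: "s \<in> set p" "t \<in> set p"
      using p by (auto simp: path_between_def gpath_def)
    consider "\<not> joined_in G (far_from G (Suc r) s) v t" | "\<not> joined_in G (far_from G (Suc r) t) v s" |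
      "\<not> joined_in G (far_from G (Suc r) v) s t"
      using narrow joined_in_sym[of G _ v s] unfolding wide_triple_def by blast
    then show ?thesis
    proof cases
      case 1
      then show ?thesis
        using gdist_le_if_not_joined[OF 1 v t s] gdist_le_diameter[OF v t] diametral st(1)
        by (intro bexI[of _ s]) auto
    next
      case 2
      then show ?thesis
        using gdist_le_if_not_joined[OF 2 v s t] gdist_le_diameter[OF v s] diametral st(2)
          gdist_commute[OF s t] by (intro bexI[of _ t]) auto
    next
      case 3
      then obtain x where "x \<in> set p" "x \<notin> far_from G (Suc r) v"
        using p unfolding joined_in_def by blast
      moreover have "x \<in> verts G"
        using p \<open>x \<in> set p\<close> by (auto simp: path_between_def gpath_def)
      ultimately show ?thesis
        using gdist_commute[OF _ v] by (intro bexI[of _ x]) (auto simp: far_from_def)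
    qed
  qed
  then show ?thesis
    using s t by (auto simp: dominating_pair_def dominating_path_def path_between_def)
qed

lemma dpr_le: "dpr G \<le> 2 * r"
  unfolding dpr_def using dominating_pair_diametral by (intro Least_le) blast

text \<open>Vertices are ordered by layer, with ties broken by an injection. For a forbidden triple,
  let \<open>y'\<close> be the vertex of a geodesic from \<open>x\<close> to \<open>z\<close> in the
  layer of \<open>y\<close>. If \<open>y\<close> and \<open>y'\<close> are within
  \<open>2 * r\<close>, the detour through \<open>y\<close> has length at most
  \<open>k + 4 * r\<close>, so one of its halves is at most \<open>k\<close>. Otherwise
  \<open>x\<close> and \<open>y\<close> are within \<open>2 * r\<close> of \<open>s\<close>, hence
  within \<open>4 * r\<close> of each other.\<close>

lemma cocomparability_power:
  assumes "4 * r \<le> k"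
  shows "cocomparability (graph_power G k)"
proof -
  obtain f :: "'a \<Rightarrow> nat" where f: "inj_on f (verts G)"
    using finite_imp_inj_to_nat_seg[OF finite_verts] by metis
  define less where "less x y \<longleftrightarrow> gdist G s x < gdist G s y \<or> gdist G s x = gdist G s y \<and> f x \<le> f y" for x y
  define R where "R = {(x, y). x \<in> verts G \<and> y \<in> verts G \<and> less x y}"
  have "refl_on (verts G) R" "trans R" "total_on (verts G) R"
    by (auto simp: refl_on_def trans_def total_on_def R_def less_def)
  moreover have "antisym R"
    using f by (auto simp: antisym_def R_def less_def inj_on_def)
  moreover have "R \<subseteq> verts G \<times> verts G"
    by (auto simp: R_def)
  ultimately have "linear_order_on (verts G) R"
    by (simp add: linear_order_on_def partial_order_on_def preorder_on_def)
  moreover have False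
    if V: "x \<in> verts G" "y \<in> verts G" "z \<in> verts G" and R: "(x, y) \<in> R" "x \<noteq> y" "(y, z) \<in> R" "y \<noteq> z"
      and adj: "\<not> adj (graph_power G k) x y" "\<not> adj (graph_power G k) y z" "adj (graph_power G k) x z"
    for x y z
  proof -
    have d: "k < gdist G x y" "k < gdist G y z" "gdist G x z \<le> k"
      using V R adj by (auto simp: adj_graph_power_iff)
    have l: "gdist G s x \<le> gdist G s y" "gdist G s y \<le> gdist G s z"
      using R by (auto simp: R_def less_def)
    obtain y' where y': "y' \<in> verts G" "gdist G s y' = gdist G s y" "gdist G x y' + gdist G y' z = gdist G x z"
      using gdist_layer[OF s V(1,3) l] .
    have "gdist G x y \<le> gdist G s x + gdist G s y"
      using gdist_triangle[OF V(1) s V(2)] gdist_commute[OF V(1) s] by simp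
    then have "gdist G y y' \<le> 2 * r"
      using same_layer_close[OF V(2) y'(1)] y'(2) l d assms by linarith
    then show False
      using gdist_triangle[OF V(1) y'(1) V(2)] gdist_triangle[OF V(2) y'(1) V(3)]
        gdist_commute[OF y'(1) V(2)] y'(3) d assms by linarith
  qed
  ultimately show ?thesis
    unfolding cocomparability_def by (intro exI[of _ R]) auto
qed

lemma pcc_le: "1 \<le> r \<Longrightarrow> pcc G \<le> 4 * r"
  unfolding pcc_def using cocomparability_power[of "4 * r"] by (intro Least_le) auto

end

context conn_graph
begin

lemma pcc_no_wide_triple: "\<nexists>u v w. wide_triple G (Suc (pcc G)) u v w"
proof -
  obtain s t where "s \<in> verts G" "t \<in> verts G" "gdist G s t = diameter"
    using diameter_attained .
  then interpret narrow_graph G diameter s t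
    by unfold_locales (use no_wide_triple_diameter in auto)
  have "\<exists>k. 1 \<le> k \<and> cocomparability (graph_power G k)"
    using cocomparability_power[of "Suc (4 * diameter)"] by (intro exI[of _ "Suc (4 * diameter)"]) simp
  then have "1 \<le> pcc G \<and> cocomparability (graph_power G (pcc G))"
    unfolding pcc_def by (rule LeastI_ex)
  then show ?thesis
    using cocomparability_power_no_wide_triple by blast
qed

section \<open>Layerings\<close>

lemma eccentricity_attained:
  obtains x where "x \<in> verts G" "gdist G s x = eccentricity G s"
proof -
  have "eccentricity G s \<in> gdist G s ` verts G"
    unfolding eccentricity_def using finite_verts verts_nonempty by (intro Max_in) auto
  then show thesis
    using that by auto
qed

lemma gdist_le_eccentricity: "x \<in> verts G \<Longrightarrow> gdist G s x \<le> eccentricity G s"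
  unfolding eccentricity_def using finite_verts by (intro Max_ge) auto

lemma adj_layer:
  assumes "s \<in> verts G" "adj G x y"
  shows "gdist G s y \<le> Suc (gdist G s x)"
  using gdist_triangle[OF assms(1) adjD(1,2)[OF assms(2)]] gdist_adj[OF assms(2)] by simp

lemma gdist_eq_1_adj:
  assumes "x \<in> verts G" "y \<in> verts G" "gdist G x y = 1"
  shows "adj G x y"
proof -
  obtain p where p: "path_between G x y p" "length p = Suc (gdist G x y)"
    using geodesic_exists[OF assms(1,2)] .
  then obtain a b where "p = [a, b]"
    using assms(3) by (auto simp: length_Suc_conv)
  then show ?thesis
    using p(1) by (auto simp: path_between_def gpath_def)
qed

lemma layer_decomposition_eccentric:
  "eccentricity G s \<noteq> 0 \<Longrightarrow> set (layer_decomposition G s) = ext_layer G s ` {1..eccentricity G s}"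
  by (simp add: layer_decomposition_def atLeastLessThanSuc_atLeastAtMost del: upt_Suc)

lemma path_decomposition_layer_decomposition:
  assumes s: "s \<in> verts G"
  shows "path_decomposition G (layer_decomposition G s)"
proof (cases "eccentricity G s = 0")
  case True
  have "x = s" if "x \<in> verts G" for x
    using gdist_le_eccentricity[OF that, of s] True gdist_eq_0[OF s that] by simp
  then have V: "verts G = {s}"
    using s by blast
  have "\<forall>e\<in>edges G. e \<subseteq> {s}"
    using V connected by (auto simp: connected_graph_def simple_graph_def)
  then show ?thesis
    using True V by (auto simp: path_decomposition_def layer_decomposition_def)
next
  case False
  have layer: "x \<in> ext_layer G s i" if "x \<in> verts G" "gdist G s x = i" for x i
    using that by (simp add: ext_layer_def layer_def)
  have prev: "x \<in> ext_layer G s (Suc i)" if "adj G x y" "gdist G s x = i" "gdist G s y = Suc i" for x y i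
    using that adjD[OF that(1)] by (auto simp: ext_layer_def layer_def)
  have level: "x \<in> verts G \<and> i \<le> Suc (gdist G s x) \<and> gdist G s x \<le> i" if "x \<in> ext_layer G s i" for x i
    using that by (auto simp: ext_layer_def layer_def)
  \<comment> \<open>The vertex \<open>s\<close> has no bag for its own layer and enters the first
    bag as a neighbour of layer 1, which is nonempty because the eccentricity is positive.\<close>
  have cover: "\<exists>i\<in>{1..eccentricity G s}. x \<in> ext_layer G s i" if x: "x \<in> verts G" for x
  proof (cases "gdist G s x")
    case 0
    obtain z where "z \<in> verts G" "gdist G s z = eccentricity G s"
      using eccentricity_attained .
    then obtain y where y: "y \<in> verts G" "gdist G s y = Suc 0"
      using gdist_intermediate[OF s, of z "Suc 0"] False by auto
    have "x = s"
      using 0 gdist_eq_0[OF s x] by simp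
    then have "adj G x y"
      using y gdist_eq_1_adj[OF s] by simp
    then show ?thesis
      using prev[of x y 0] 0 y False by (intro bexI[of _ "Suc 0"]) auto
  next
    case (Suc i)
    then show ?thesis
      using layer[OF x] gdist_le_eccentricity[OF x, of s] by (intro bexI[of _ "gdist G s x"]) auto
  qed
  have edge: "\<exists>i\<in>{1..eccentricity G s}. x \<in> ext_layer G s i \<and> y \<in> ext_layer G s i"
    if xy: "adj G x y" "gdist G s x \<le> gdist G s y" for x y
  proof -
    note V = adjD[OF xy(1)]
    have "gdist G s y \<noteq> 0"
      using gdist_eq_0[OF s] V xy(2) by (metis le_zero_eq)
    moreover have "x \<in> ext_layer G s (gdist G s y)"
      using layer[of x] prev[OF xy(1)] V adj_layer[OF s xy(1)] xy(2) le_Suc_eq by fastforce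
    ultimately show ?thesis
      using layer[of y] V(2) gdist_le_eccentricity[OF V(2), of s]
      by (intro bexI[of _ "gdist G s y"]) auto
  qed
  have "\<Union> (set (layer_decomposition G s)) = verts G"
    unfolding layer_decomposition_eccentric[OF False] using cover level by blast
  moreover have "\<exists>X\<in>set (layer_decomposition G s). e \<subseteq> X" if e: "e \<in> edges G" for e
  proof -
    have "card e = 2"
      using e connected by (simp add: connected_graph_def simple_graph_def)
    then obtain x y where xy: "e = {x, y}"
      by (auto simp: card_2_iff)
    then have "adj G x y" "adj G y x"
      using e by (simp_all add: adj_def insert_commute)
    then have "\<exists>i\<in>{1..eccentricity G s}. x \<in> ext_layer G s i \<and> y \<in> ext_layer G s i"
      using edge[of x y] edge[of y x] by (meson nat_le_linear)
    then show ?thesis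
      unfolding layer_decomposition_eccentric[OF False] xy by blast
  qed
  moreover have "layer_decomposition G s ! i \<inter> layer_decomposition G s ! k \<subseteq> layer_decomposition G s ! j"
    if ijk: "i \<le> j" "j \<le> k" "k < length (layer_decomposition G s)" for i j k
  proof -
    have k: "k < eccentricity G s"
      using ijk(3) False by (simp add: layer_decomposition_def)
    \<comment> \<open>The list is indexed from 0, the extended layers from 1.\<close>
    have nth: "layer_decomposition G s ! l = ext_layer G s (Suc l)" if "l \<le> k" for l
      using that k False by (simp add: layer_decomposition_def del: upt_Suc)
    \<comment> \<open>A vertex belongs at most to the bags of its own and of the next layer, so its
      bags are at most two consecutive ones.\<close>
    have "j = i \<or> j = k" if "x \<in> ext_layer G s (Suc i)" "x \<in> ext_layer G s (Suc k)" for x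
      using level[OF that(1)] level[OF that(2)] ijk by linarith
    then show ?thesis
      using ijk nth by auto
  qed
  ultimately show ?thesis
    unfolding path_decomposition_def by blast
qed

lemma decomposition_length_le:
  assumes "path_decomposition G Xs"
    and "\<And>X u v. X \<in> set Xs \<Longrightarrow> u \<in> X \<Longrightarrow> v \<in> X \<Longrightarrow> gdist G u v \<le> l"
  shows "decomposition_length G Xs \<le> l"
proof -
  define D where "D = {gdist G u v | u v. \<exists>X\<in>set Xs. u \<in> X \<and> v \<in> X}"
  have sub: "D \<subseteq> {..l}"
    unfolding D_def using assms(2) by blast
  obtain x where "x \<in> verts G"
    using verts_nonempty by blast
  then obtain X where "X \<in> set Xs" "x \<in> X"
    using assms(1) unfolding path_decomposition_def by blast
  then have "gdist G x x \<in> D"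
    unfolding D_def by blast
  then have "Max D \<in> D"
    using finite_subset[OF sub] by (intro Max_in) auto
  then show ?thesis
    using sub by (auto simp: decomposition_length_def D_def[symmetric])
qed

lemma pl_le_min_layering_length: "pl G \<le> min_layering_length G"
proof -
  have "min_layering_length G \<in> layering_length G ` verts G"
    unfolding min_layering_length_def using finite_verts verts_nonempty by (intro Min_in) auto
  then obtain s where "s \<in> verts G" "min_layering_length G = decomposition_length G (layer_decomposition G s)"
    by (auto simp: layering_length_def)
  then show ?thesis
    unfolding pl_def using path_decomposition_layer_decomposition by (intro Least_le) auto
qed

end

context narrow_graph
begin

text \<open>A bag mixes two consecutive layers. A vertex of the lower layer is exchanged for a
  neighbour in the upper one, which accounts for the \<open>+ 1\<close>.\<close>

lemma min_layering_length_le: "min_layering_length G \<le> 4 * r + 1"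
proof -
  have "gdist G u v \<le> 4 * r + 1" if X: "X \<in> set (layer_decomposition G s)" "u \<in> X" "v \<in> X" for X u v
  proof (cases "eccentricity G s = 0")
    case True
    then show ?thesis
      using X s by (simp add: layer_decomposition_def)
  next
    case False
    then obtain i where i: "X = ext_layer G s i"
      using X(1) layer_decomposition_eccentric by auto
    have close: "gdist G x y \<le> 4 * r" if "x \<in> layer G s j" "y \<in> layer G s j" for x y j
      using that same_layer_le by (simp add: layer_def)
    have step: "gdist G x y \<le> 4 * r + 1"
      if "x \<in> layer G s i" "y \<in> verts G" "w \<in> layer G s i" "adj G y w" for x y w
    proof -
      have V: "x \<in> verts G" "w \<in> verts G"
        using that by (auto simp: layer_def)
      show ?thesis
        using gdist_triangle[OF V(1,2) that(2)] close[OF that(1,3)] gdist_adj[OF that(4)]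
          gdist_commute[OF V(2) that(2)] by linarith
    qed
    have V: "u \<in> verts G" "v \<in> verts G"
      using X unfolding i by (auto simp: ext_layer_def layer_def)
    consider "u \<in> layer G s i" "v \<in> layer G s i" | "u \<in> layer G s (i - 1)" "v \<in> layer G s (i - 1)" |
      w where "u \<in> layer G s i" "w \<in> layer G s i" "adj G v w" |
      w where "v \<in> layer G s i" "w \<in> layer G s i" "adj G u w"
      using X(2,3) unfolding i ext_layer_def by blast
    then show ?thesis
    proof cases
      case 1
      then show ?thesis
        using close[OF 1] by simp
    next
      case 2
      then show ?thesis
        using close[OF 2] by simp
    next
      case 3
      then show ?thesis
        using step V by blast
    next
      case 4
      then show ?thesis
        using step[OF 4(1) V(1) 4(2,3)] gdist_commute[OF V] by simp
    qed
  qed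
  then have "layering_length G s \<le> 4 * r + 1"
    unfolding layering_length_def
    by (intro decomposition_length_le path_decomposition_layer_decomposition s)
  moreover have "min_layering_length G \<le> layering_length G s"
    unfolding min_layering_length_def using finite_verts s by (intro Min_le) auto
  ultimately show ?thesis
    by simp
qed

end

section \<open>Caterpillar trees\<close>

lemma path_between_Cons:
  assumes "path_between G u v p" "adj G x u" "x \<in> verts G" "x \<notin> set p"
  shows "path_between G x v (x # p)"
  using assms by (cases p) (auto simp: path_between_def gpath_def)

lemma path_between_snoc:
  assumes "path_between G u v p" "adj G v x" "x \<in> verts G" "x \<notin> set p"
  shows "path_between G u x (p @ [x])"
  using path_between_rev[OF path_between_Cons[OF path_between_rev[OF assms(1)], of x]] assms(2-)
  by (simp add: adj_commute)

text \<open>If \<open>x\<close> and \<open>y\<close> were joined around \<open>z\<close>, the two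
  neighbours of \<open>z\<close> on \<open>q\<close> would be joined without \<open>z\<close>, and
  \<open>z\<close> would close a cycle.\<close>

lemma is_tree_path_separates:
  assumes tree: "is_tree T" and q: "path_between T x y q" "z \<in> set q" and z: "z \<notin> S"
  shows "\<not> joined_in T S x y"
proof
  assume j: "joined_in T S x y"
  have xy: "x \<noteq> z" "y \<noteq> z"
    using joined_inD[OF j] z by auto
  obtain q1 q2 where q12: "q = q1 @ z # q2"
    using q(2) by (meson split_list)
  have ne: "q1 \<noteq> []" "q2 \<noteq> []"
    using q(1) xy unfolding q12 path_between_def by (auto split: if_splits)
  define x' y' where "x' = last q1" and "y' = hd q2"
  have g: "gpath T (q1 @ z # q2)" "hd q1 = x" "last q2 = y"
    using q(1) ne unfolding q12 path_between_def by auto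
  have adj: "adj T x' z" "adj T z y'" and "set q1 \<inter> set q2 = {}"
    using g(1) ne by (auto simp: gpath_def successively_append_iff successively_Cons x'_def y'_def)
  then have ne': "x' \<noteq> y'"
    using last_in_set[OF ne(1)] hd_in_set[OF ne(2)] unfolding x'_def y'_def by (metis disjoint_iff)
  have "gpath T q1" "gpath T q2" "z \<notin> set q1" "z \<notin> set q2" "z \<in> verts T"
    using gpath_appendD1[OF g(1) ne(1)] gpath_appendD2[of T "q1 @ [z]" q2] g(1) ne(2)
    by (auto simp: gpath_def)
  then have "joined_in T (- {z}) x x'" "joined_in T (- {z}) y' y"
    using g(2,3) unfolding joined_in_def path_between_def x'_def y'_def by blast+
  then have "joined_in T (- {z}) x' y'"
    using joined_in_mono[OF j, of "- {z}"] z joined_in_sym joined_in_trans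
    by (metis Compl_iff insert_iff singletonD subsetI)
  then obtain p where p: "path_between T x' y' p" "z \<notin> set p"
    by (auto simp: joined_in_def)
  have "path_between T z y' (z # p)"
    using path_between_Cons[OF p(1)] adj(1) p(2) \<open>z \<in> verts T\<close> by (simp add: adj_commute)
  moreover have "3 \<le> length (z # p)"
    using p(1) ne' by (cases p; cases "tl p") (auto simp: path_between_def gpath_def)
  ultimately have "is_cycle T (z # p)"
    using adj(2) by (auto simp: is_cycle_def path_between_def adj_commute)
  then show False
    using tree by (auto simp: is_tree_def)
qed

text \<open>Each vertex is assigned the position on the spine where it sits or is attached. The path
  from \<open>a\<close> to \<open>c\<close> along the spine passes the vertex at which
  \<open>b\<close> sits or is attached, so in a tree every path from \<open>a\<close> to
  \<open>c\<close> does, and that vertex is within 1 of \<open>b\<close>.\<close>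

lemma caterpillar_no_wide_triple:
  assumes "caterpillar T"
  shows "\<nexists>u v w. wide_triple T 2 u v w"
proof (intro notI, elim exE)
  fix u v w
  assume *: "wide_triple T 2 u v w"
  interpret conn_graph T
    using assms by unfold_locales (simp add: caterpillar_def is_tree_def)
  obtain p where p: "gpath T p" and dom: "\<And>v. v \<in> verts T \<Longrightarrow> \<exists>x\<in>set p. gdist T v x \<le> 1"
    using assms by (auto simp: caterpillar_def dominating_path_def)
  have pV: "p ! i \<in> verts T" if "i < length p" for i
    using p that nth_mem unfolding gpath_def by blast
  have "\<exists>i<length p. x = p ! i \<or> x \<notin> set p \<and> adj T x (p ! i)" if x: "x \<in> verts T" for x
  proof (cases "x \<in> set p")
    case True
    then show ?thesis
      by (auto simp: in_set_conv_nth)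
  next
    case False
    obtain i where i: "i < length p" "gdist T x (p ! i) \<le> 1"
      using dom[OF x] by (auto simp: in_set_conv_nth)
    then have "x \<noteq> p ! i"
      using False by auto
    then have "gdist T x (p ! i) = 1"
      using i gdist_eq_0[OF x pV[OF i(1)]] by linarith
    then show ?thesis
      using gdist_eq_1_adj[OF x pV[OF i(1)]] i(1) False by blast
  qed
  then obtain f where f: "\<And>x. x \<in> verts T \<Longrightarrow>
      f x < length p \<and> (x = p ! f x \<or> x \<notin> set p \<and> adj T x (p ! f x))"
    by metis
  obtain a b c where abc: "a \<in> verts T" "b \<in> verts T" "c \<in> verts T" "f a \<le> f b" "f b \<le> f c"
    and j: "joined_in T (far_from T 2 b) a c" and ac: "2 \<le> gdist T a c"
    by (rule wide_triple_middle[OF *, where R = "\<lambda>x y. f x \<le> f y"]) auto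
  let ?z = "p ! f b"
  define m where "m = drop (f a) (take (Suc (f c)) p)"
  have m: "path_between T (p ! f a) (p ! f c) m"
    unfolding m_def using path_between_segment[OF p] abc f by simp
  have mp: "set m \<subseteq> set p"
    unfolding m_def by (meson set_drop_subset set_take_subset subset_trans)
  have "m ! (f b - f a) = ?z" "f b - f a < length m"
    using abc f[OF abc(3)] by (auto simp: m_def)
  then have zm: "?z \<in> set m"
    by (metis nth_mem)
  obtain m' where m': "path_between T a (p ! f c) m'" "set m \<subseteq> set m'" "set m' \<subseteq> insert a (set m)"
  proof (cases "a = p ! f a")
    case True
    then show thesis
      using that m by auto
  next
    case False
    then show thesis
      using that[OF path_between_Cons[OF m]] f[OF abc(1)] abc(1) mp by auto
  qed
  \<comment> \<open>If \<open>c\<close> is off the spine, it could occur on \<open>m'\<close> only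
    as \<open>a\<close>, which \<open>ac\<close> excludes.\<close>
  have "\<exists>q. path_between T a c q \<and> set m' \<subseteq> set q"
  proof (cases "c = p ! f c")
    case True
    then show ?thesis
      using m'(1) by auto
  next
    case False
    then have "c \<notin> set m'" "adj T (p ! f c) c"
      using f[OF abc(3)] m'(3) mp ac abc(1) by (auto simp: adj_commute)
    then show ?thesis
      using path_between_snoc[OF m'(1)] abc(3) by fastforce
  qed
  then obtain q where "path_between T a c q" "?z \<in> set q"
    using m'(2) zm by blast
  moreover have "?z \<notin> far_from T 2 b"
    using f[OF abc(2)] gdist_adj[of b ?z] gdist_commute[of b ?z] abc(2) pV[of "f b"]
    by (auto simp: far_from_def)
  ultimately show False
    using is_tree_path_separates[of T a c q ?z] assms j by (auto simp: caterpillar_def)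
qed

lemma is_cycle_rotate: "is_cycle G (xs @ ys) \<Longrightarrow> is_cycle G (ys @ xs)"
  by (cases "xs = []"; cases "ys = []")
    (auto simp: is_cycle_def gpath_def successively_append_iff)

text \<open>At a vertex of a cycle where \<open>f\<close> is largest, both neighbours on the cycle
  would be the parent \<open>g x\<close>, yet they are distinct.\<close>

lemma no_cycle_if_parent_unique:
  fixes f :: "'a \<Rightarrow> nat"
  assumes parent: "\<And>x y. adj T x y \<Longrightarrow> f y \<le> f x \<Longrightarrow> y = g x"
  shows "\<not> is_cycle T c"
proof
  assume c: "is_cycle T c"
  then have "set c \<noteq> {}"
    by (auto simp: is_cycle_def gpath_def)
  then have "Max (f ` set c) \<in> f ` set c"
    by (intro Max_in) auto
  then obtain x where x: "x \<in> set c" "f x = Max (f ` set c)"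
    by auto
  have max: "f y \<le> f x" if "y \<in> set c" for y
    using x(2) that by simp
  obtain xs ys where xys: "c = xs @ x # ys"
    using x(1) by (meson split_list)
  have cyc: "is_cycle T (x # ys @ xs)"
    using is_cycle_rotate[of T xs "x # ys"] c xys by simp
  then obtain y zs where yz: "ys @ xs = y # zs" "zs \<noteq> []"
    by (cases "ys @ xs"; cases "tl (ys @ xs)") (auto simp: is_cycle_def)
  have "set c = insert x (set (ys @ xs))"
    using xys by auto
  then have sub: "set (y # zs) \<subseteq> set c"
    using yz(1) by auto
  have "adj T x y" "adj T x (last zs)" "y \<notin> set zs"
    using cyc yz(2) unfolding yz(1) by (auto simp: is_cycle_def gpath_def adj_commute)
  moreover have "last zs \<in> set zs"
    using yz(2) by simp
  ultimately show False
    using parent[of x y] parent[of x "last zs"] max[of y] max[of "last zs"] sub by auto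
qed

context conn_graph
begin

text \<open>Distance \<open>2 * k + 2\<close> in \<open>G\<close> leaves at least
  \<open>k + 2\<close> in \<open>T\<close>, and edges of \<open>G\<close> have length at most
  \<open>k + 1\<close> in \<open>T\<close>. Replacing them by geodesics of \<open>T\<close> halves
  that loss and leaves distance 2, which a caterpillar does not allow.\<close>

lemma distortion_no_wide_triple:
  assumes T: "caterpillar T" "verts T = verts G"
    and k: "\<And>u v. u \<in> verts G \<Longrightarrow> v \<in> verts G \<Longrightarrow> \<bar>int (gdist G u v) - int (gdist T u v)\<bar> \<le> int k"
  shows "\<nexists>u v w. wide_triple G (2 * k + 2) u v w"
proof (intro notI, elim exE)
  fix u v w
  assume *: "wide_triple G (2 * k + 2) u v w"
  interpret T: conn_graph T
    using T by unfold_locales (simp add: caterpillar_def is_tree_def)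
  have le: "gdist G x y \<le> gdist T x y + k" "gdist T x y \<le> gdist G x y + k"
    if "x \<in> verts G" "y \<in> verts G" for x y
    using k[OF that] by linarith+
  have "joined_in T (far_from T 2 z) x y" if j: "joined_in G (far_from G (2 * k + 2) z) x y" "z \<in> verts G"
    for x y z
  proof (rule T.joined_in_coarse_far_from)
    show "joined_in G (far_from T (k + 2) z) x y"
      using j(1)
    proof (rule joined_in_mono, intro subsetI)
      show "a \<in> far_from T (k + 2) z" if "a \<in> far_from G (2 * k + 2) z" for a
        using that le(1)[of a z] j(2) T(2) by (auto simp: far_from_def)
    qed
    show "gdist T a b \<le> k + 1" if "adj G a b" for a b
      using le(2)[of a b] gdist_adj[OF that] adjD[OF that] by simp
  qed (use j(2) T(2) in auto)
  then have "wide_triple T 2 u v w"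
    using * wide_triple_verts[OF *] by (simp add: wide_triple_def)
  then show False
    using caterpillar_no_wide_triple[OF T(1)] by blast
qed

text \<open>Bounds distances from below; it is applied to the tree with the layer number as
  potential.\<close>

lemma potential_le:
  assumes "\<And>x y. adj G x y \<Longrightarrow> f x \<le> Suc (f y)" "u \<in> verts G" "v \<in> verts G"
  shows "f u \<le> f v + gdist G u v"
proof -
  obtain p where p: "path_between G u v p" "length p = Suc (gdist G u v)"
    using geodesic_exists[OF assms(2,3)] .
  have "f (hd p) \<le> f (last p) + (length p - 1)" if "successively (adj G) p" "p \<noteq> []" for p
    using that
  proof (induction p rule: induct_list012)
    case (3 x y zs)
    then have "f y \<le> f (last (y # zs)) + (length (y # zs) - 1)" "f x \<le> Suc (f y)"
      using assms(1)[of x y] by auto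
    then show ?case
      by simp
  qed auto
  from this[of p] show ?thesis
    using p by (auto simp: path_between_def gpath_def)
qed

end

text \<open>The spine \<open>v 0, v 1, \<dots>\<close> picks one vertex of each layer, and every vertex of layer \<open>m + 1\<close>
  is attached to \<open>v m\<close>.\<close>

lemma (in conn_graph) layer_caterpillar:
  assumes s: "s \<in> verts G"
    and close: "\<And>x y. x \<in> verts G \<Longrightarrow> y \<in> verts G \<Longrightarrow> gdist G s x = gdist G s y \<Longrightarrow> gdist G x y \<le> k"
    and k: "2 \<le> k"
  shows "\<exists>T. caterpillar T \<and> verts T = verts G \<and>
    (\<forall>x\<in>verts G. \<forall>y\<in>verts G. \<bar>int (gdist G x y) - int (gdist T x y)\<bar> \<le> int k)"
proof -
  define d where "d = gdist G s"
  \<comment> \<open>For \<open>m\<close> beyond the last layer, \<open>v m\<close> is an arbitrary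
    value.\<close>
  define v where "v m = (SOME x. x \<in> verts G \<and> d x = m)" for m
  have v: "v m \<in> verts G \<and> d (v m) = m" if "m \<le> d x" "x \<in> verts G" for m x
  proof -
    have "\<exists>y. y \<in> verts G \<and> d y = m"
      using gdist_intermediate[OF s that(2), of m] that(1) unfolding d_def by metis
    then show ?thesis
      unfolding v_def by (rule someI_ex)
  qed
  have d0: "d x = 0 \<longleftrightarrow> x = s" if "x \<in> verts G" for x
    using gdist_eq_0[OF s that] by (auto simp: d_def)
  have v0: "v 0 = s"
    using v[OF _ s, of 0] d0[of "v 0"] by simp
  define T where "T = \<lparr>verts = verts G, edges = {{x, v (d x - 1)} | x. x \<in> verts G \<and> x \<noteq> s}\<rparr>"
  have VT: "verts T = verts G"
    by (simp add: T_def)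
  have parent: "v (d x - 1) \<in> verts G" "Suc (d (v (d x - 1))) = d x" "adj T x (v (d x - 1))"
    if "x \<in> verts G" "x \<noteq> s" for x
    using v[of "d x - 1" x] d0[OF that(1)] that by (auto simp: adj_def T_def)
  have adj_cases: "x \<in> verts G \<and> y \<in> verts G \<and>
      (x \<noteq> s \<and> y = v (d x - 1) \<and> Suc (d y) = d x \<or> y \<noteq> s \<and> x = v (d y - 1) \<and> Suc (d x) = d y)"
    if "adj T x y" for x y
  proof -
    obtain z where "z \<in> verts G" "z \<noteq> s" "{x, y} = {z, v (d z - 1)}"
      using \<open>adj T x y\<close> by (auto simp: adj_def T_def)
    then show ?thesis
      using parent[of z] by (auto simp: doubleton_eq_iff)
  qed
  have "simple_graph T"
    using finite_verts verts_nonempty parent(1,2) by (fastforce simp: simple_graph_def T_def card_2_iff)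
  moreover have to_s: "joined_in T (verts G) x s" if "x \<in> verts G" for x
    using that
  proof (induction "d x" arbitrary: x)
    case 0
    then show ?case
      using d0 s by (auto intro: joined_in_refl simp: VT)
  next
    case (Suc n)
    then have xs: "x \<noteq> s"
      using d0 by force
    note px = parent[OF Suc(3) xs]
    have "joined_in T (verts G) x (v (d x - 1))"
      using px Suc(3) by (intro joined_in_adj) (auto simp: VT)
    moreover have "joined_in T (verts G) (v (d x - 1)) s"
      using Suc(1)[of "v (d x - 1)"] Suc(2) px by simp
    ultimately show ?case
      by (rule joined_in_trans)
  qed
  have "\<exists>p. path_between T x y p" if "x \<in> verts T" "y \<in> verts T" for x y
    using joined_in_trans[OF to_s joined_in_sym[OF to_s], of x y] that
    unfolding VT joined_in_def by blast
  ultimately have conn: "connected_graph T"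
    by (simp add: connected_graph_def)
  then interpret T: conn_graph T
    by unfold_locales
  have "\<not> is_cycle T c" for c
  proof (rule no_cycle_if_parent_unique)
    show "y = v (d x - 1)" if "adj T x y" "d y \<le> d x" for x y
      using adj_cases[OF that(1)] that(2) by (metis Suc_n_not_le_n)
  qed
  then have tree: "is_tree T"
    using conn by (simp add: is_tree_def)
  obtain z where z: "z \<in> verts G" "d z = eccentricity G s"
    using eccentricity_attained unfolding d_def by blast
  have ecc: "d x \<le> d z" if "x \<in> verts G" for x
    using gdist_le_eccentricity[OF that, of s] z(2) by (simp add: d_def)
  have vz: "v m \<in> verts G" "d (v m) = m" if "m \<le> d z" for m
    using v[OF that z(1)] by auto
  have "dominating_path T 1 (map v [0..<Suc (d z)])"
    unfolding dominating_path_def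
  proof (intro conjI ballI)
    have "inj_on v {0..<Suc (d z)}"
      using vz(2) by (intro inj_on_inverseI[where g = d]) auto
    moreover have "adj T (v m) (v (Suc m))" if "Suc m \<le> d z" for m
      using parent(3)[of "v (Suc m)"] vz[OF that] d0[of "v (Suc m)"] by (auto simp: adj_commute)
    ultimately show "gpath T (map v [0..<Suc (d z)])"
      using vz(1) by (auto simp: gpath_def VT distinct_map successively_conv_nth simp del: upt_Suc)
    fix x
    assume "x \<in> verts T"
    then have x: "x \<in> verts G"
      by (simp add: VT)
    have spine: "v m \<in> set (map v [0..<Suc (d z)])" if "m \<le> d z" for m
      using that by (simp del: upt_Suc)
    show "\<exists>y\<in>set (map v [0..<Suc (d z)]). gdist T x y \<le> 1"
    proof (cases "x = s")
      case True
      then show ?thesis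
        using v0 T.gdist_self[of s] s VT by (intro bexI[OF _ spine[of 0]]) auto
    next
      case False
      then show ?thesis
        using T.gdist_adj[OF parent(3)[OF x]] ecc[OF x] by (intro bexI[OF _ spine[of "d x - 1"]]) auto
    qed
  qed
  then have "caterpillar T"
    using tree by (auto simp: caterpillar_def)
  moreover have "\<bar>int (gdist G x y) - int (gdist T x y)\<bar> \<le> int k"
    if "x \<in> verts G" "y \<in> verts G" for x y
  proof -
    \<comment> \<open>Strictness matters: \<open>x\<close> need not be the spine vertex of its own
      layer, and is then at distance 2 from it, by way of the common parent.\<close>
    have down: "gdist T x (v m) \<le> d x - m" if "x \<in> verts G" "m < d x" for x m
      using that
    proof (induction "d x" arbitrary: x)
      case (Suc n)
      then have xs: "x \<noteq> s"
        using d0[OF s] by auto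
      note px = parent[OF Suc(3) xs]
      have step: "gdist T x (v (d x - 1)) \<le> 1"
        using T.gdist_adj[OF px(3)] .
      show ?case
      proof (cases "m = n")
        case True
        then show ?thesis
          using step Suc(2) by (metis Suc_diff_le diff_Suc_1 diff_self_eq_0 le_refl One_nat_def)
      next
        case False
        then have "gdist T (v (d x - 1)) (v m) \<le> n - m"
          using Suc(1)[of "v (d x - 1)"] Suc(2,4) px by simp
        then show ?thesis
          using T.gdist_triangle[of x "v (d x - 1)" "v m"] step px(1) v[of m x] Suc(2-4) False VT by simp
      qed
    qed simp
    \<comment> \<open>Let \<open>D = d y - d x\<close>. The distance in \<open>G\<close> lies
      between \<open>D\<close> and \<open>D + k\<close>, and the distance in \<open>T\<close>
      between \<open>D\<close> and \<open>D + 2\<close>, since both vertices reach the parent of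
      \<open>x\<close> along the tree. So they differ by at most \<open>max k 2\<close>, which is
      \<open>k\<close>. For \<open>d x = 0\<close> there is no parent, and \<open>x = s\<close> is
      itself on the spine.\<close>
    have bound: "\<bar>int (gdist G x y) - int (gdist T x y)\<bar> \<le> int k"
      if V: "x \<in> verts G" "y \<in> verts G" and le: "d x \<le> d y" for x y
    proof -
      obtain z where z: "z \<in> verts G" "d z = d x" "gdist G z y = d y - d x"
        using gdist_intermediate[OF s V(2), of "d x"] le unfolding d_def by metis
      have "gdist G x y \<le> k + (d y - d x)"
        using gdist_triangle[OF V(1) z(1) V(2)] close[OF V(1) z(1)] z(2,3) by (simp add: d_def)
      moreover have "d y \<le> d x + gdist G x y"
        using gdist_triangle[OF s V] by (simp add: d_def)
      moreover have "d y \<le> d x + gdist T y x"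
        using T.potential_le[of d y x] adj_cases V VT by fastforce
      moreover have "gdist T x y \<le> (d y - d x) + 2"
      proof (cases "d x")
        case 0
        have "gdist T y s \<le> d y"
          using down[OF V(2), of 0] d0[OF V(2)] v0 T.gdist_self[of s] s VT by (cases "d y = 0") auto
        moreover have "x = s"
          using 0 d0[OF V(1)] by simp
        ultimately show ?thesis
          using T.gdist_commute[of x y] V VT 0 by simp
      next
        case (Suc m)
        then have "gdist T x (v m) \<le> 1" "gdist T y (v m) \<le> d y - m" "v m \<in> verts G"
          using down[of x m] down[of y m] v[of m x] V le by auto
        then show ?thesis
          using T.gdist_triangle[of x "v m" y] T.gdist_commute[of y "v m"] V VT le Suc by auto
      qed
      moreover have "gdist T x y = gdist T y x"
        using T.gdist_commute V VT by simp
      ultimately show ?thesis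
        using k le by linarith
    qed
    show ?thesis
      using bound[OF that] bound[OF that(2,1)] gdist_commute[OF that] T.gdist_commute[of x y] that VT
      by (metis nat_le_linear)
  qed
  ultimately show ?thesis
    using VT by blast
qed

context conn_graph
begin

text \<open>The layers trivially have diameter at most \<open>diameter + 2\<close>, so some
  caterpillar exists and the minimum in \<open>adc\<close> is attained; the summand 2 meets the
  requirement \<open>2 \<le> k\<close> of the construction.\<close>

lemma adc_no_wide_triple: "\<nexists>u v w. wide_triple G (2 * adc G + 2) u v w"
proof -
  obtain s where "s \<in> verts G"
    using verts_nonempty by blast
  then have "\<exists>k T. caterpillar T \<and> verts T = verts G \<and>
      (\<forall>u\<in>verts G. \<forall>v\<in>verts G. \<bar>int (gdist G u v) - int (gdist T u v)\<bar> \<le> int k)"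
    using layer_caterpillar[of s "diameter + 2"] gdist_le_diameter by (meson le_add2 trans_le_add1)
  then have "\<exists>T. caterpillar T \<and> verts T = verts G \<and>
      (\<forall>u\<in>verts G. \<forall>v\<in>verts G. \<bar>int (gdist G u v) - int (gdist T u v)\<bar> \<le> int (adc G))"
    unfolding adc_def by (rule LeastI_ex)
  then show ?thesis
    using distortion_no_wide_triple by blast
qed

end

lemma (in narrow_graph) adc_le: "1 \<le> r \<Longrightarrow> adc G \<le> 4 * r"
  unfolding adc_def by (rule Least_le, rule layer_caterpillar[OF s same_layer_le]) auto

theorem theorem5:
  fixes G :: "'a ugraph"
  assumes "connected_graph G"
  shows "(mfi G \<le> mci G \<and> mci G \<le> 4 * mfi G + 3) \<and>
    (mfi G \<le> pl G \<and> pl G \<le> 16 * mfi G + 10) \<and>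
    (real (mfi G) / 2 \<le> real (pat G) \<and> pat G \<le> 8 * mfi G + 5) \<and>
    ((real (mfi G) - 1) / 2 \<le> real (adc G) \<and> adc G \<le> 16 * mfi G + 10) \<and>
    (mfi G \<le> min_layering_length G \<and> min_layering_length G \<le> 16 * mfi G + 12) \<and>
    (real (mfi G) / 4 \<le> real (dsp G) \<and> dsp G \<le> dpr G \<and> dpr G \<le> 8 * mfi G + 5) \<and>
    (real (mfi G) / 2 \<le> real (pcc G) \<and> pcc G \<le> 16 * mfi G + 10)"
proof -
  interpret conn_graph G
    using assms by unfold_locales
  have narrow: "\<nexists>u v w. wide_triple G (Suc (4 * mfi G + 2)) u v w"
    using mfi_no_wide_triple by (simp add: numeral_3_eq_3)
  obtain s t where "s \<in> verts G" "t \<in> verts G" "gdist G s t = diameter"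
    using diameter_attained .
  then interpret narrow_graph G "4 * mfi G + 2" s t
    using narrow by unfold_locales
  \<comment> \<open>With \<open>r = 4 * mfi G + 2\<close>, the values \<open>4 * r\<close>,
    \<open>4 * r + 1\<close>, \<open>2 * r\<close> and \<open>2 * r + 1\<close> are
    \<open>16 * mfi G + 8\<close>, \<open>16 * mfi G + 9\<close>, \<open>8 * mfi G + 4\<close> and
    \<open>8 * mfi G + 5\<close>. The bound for \<open>pl\<close> is inherited from the layering,
    and those for \<open>dsp\<close> from \<open>3 * dsp G\<close> and from
    \<open>dpr\<close>.\<close>
  have "mfi G \<le> mci G" "mfi G \<le> pl G" "mfi G \<le> pat G" "mfi G \<le> pcc G" "mfi G \<le> 3 * dsp G"
    by (intro mfi_le mci_no_wide_triple pl_no_wide_triple pat_no_wide_triple pcc_no_wide_triple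
        dsp_no_wide_triple)+
  moreover have "mfi G \<le> 2 * adc G + 1"
    using mfi_le adc_no_wide_triple by simp
  moreover have "mci G \<le> 4 * mfi G + 2" "pat G \<le> 2 * (4 * mfi G + 2) + 1"
    using narrow by (intro mci_le pat_le; simp)+
  moreover have "adc G \<le> 4 * (4 * mfi G + 2)" "pcc G \<le> 4 * (4 * mfi G + 2)"
    by (intro adc_le pcc_le; simp)+
  ultimately show ?thesis
    using pl_le_min_layering_length min_layering_length_le dsp_le_dpr dpr_le by auto
qed

end
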